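(* Let $q$ be a prime power, let $n\ge 3$ be an integer, and let $\mathcal{Q}_1=Z(F_1)$ and $\mathcal{Q}_2=Z(F_2)$ be two quadrics in $\mathbb{P}^n(\mathbb{F}_q)$, where $F_1,F_2\in\mathbb{F}_q[x_0,\dots,x_n]$ are nonzero homogeneous forms of degree $2$, such that $\mathcal{Q}_1$ and $\mathcal{Q}_2$ have no common hyperplane (i.e. $F_1$ and $F_2$ have no common linear factor). Then $$|\mathcal{Q}_1\cap\mathcal{Q}_2|\le 4q^{n-2}+\pi_{n-3},$$ where $|\cdot|$ denotes the number of $\mathbb{F}_q$-rational points of $\mathbb{P}^n(\mathbb{F}_q)$. Moreover this bound is the best possible: there exist two such quadrics in $\mathbb{P}^n(\mathbb{F}_q)$ with no common hyperplane for which equality holds.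
   Context: $\mathbb{F}_q$ is the finite field with $q$ elements and $\mathbb{P}^n(\mathbb{F}_q)$ is the $n$-dimensional projective space over $\mathbb{F}_q$. For an integer $m\ge 0$, $\pi_m=|\mathbb{P}^m(\mathbb{F}_q)|=q^m+q^{m-1}+\dots+q+1$. A quadric $Z(F)$ is the set of points of $\mathbb{P}^n(\mathbb{F}_q)$ at which the quadratic form $F$ vanishes.
   Formalization: The two quadrics are taken to be distinct in that F_1 and F_2 are not scalar multiples of each other; otherwise the bound fails, e.g. F_1 = F_2 = x_0x_1 - x_2x_3 over F_3 with n = 3 has 16 > 13 points. *)

theory Defs
  imports "HOL-Library.Poly_Mapping" "HOL-Library.Cardinality"
begin

text \<open>
  The polynomials over a commutative ring in the variables \<open>x\<^sub>0, x\<^sub>1, \<dots>\<close> are the finitely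
  supported maps from exponent vectors to coefficients. Membership in
  \<open>F\<^sub>q[x\<^sub>0, \<dots>, x\<^sub>n]\<close> is expressed by \<open>is_form\<close> below.
\<close>

type_synonym 'a mpoly = "(nat \<Rightarrow>\<^sub>0 nat) \<Rightarrow>\<^sub>0 'a"

definition monomial_degree :: "(nat \<Rightarrow>\<^sub>0 nat) \<Rightarrow> nat" where
  "monomial_degree m = (\<Sum>i\<in>Poly_Mapping.keys m. Poly_Mapping.lookup m i)"

definition is_form :: "nat \<Rightarrow> nat \<Rightarrow> 'a::zero mpoly \<Rightarrow> bool" where
  "is_form n d F \<longleftrightarrow>
     (\<forall>m\<in>Poly_Mapping.keys F. Poly_Mapping.keys m \<subseteq> {..n} \<and> monomial_degree m = d)"

definition poly_eval :: "'a::comm_semiring_1 mpoly \<Rightarrow> (nat \<Rightarrow> 'a) \<Rightarrow> 'a" where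
  "poly_eval F v =
     (\<Sum>m\<in>Poly_Mapping.keys F. Poly_Mapping.lookup F m *
        (\<Prod>i\<in>Poly_Mapping.keys m. v i ^ Poly_Mapping.lookup m i))"

text \<open>
  A vector of \<open>F\<^sub>q\<^bsup>n+1\<^esup>\<close> is a function on \<open>nat\<close> that vanishes beyond \<open>n\<close>, so that equality of
  functions is equality of vectors.
\<close>

definition nonzero_vectors :: "nat \<Rightarrow> (nat \<Rightarrow> 'a::zero) set" where
  "nonzero_vectors n = {v. (\<forall>i>n. v i = 0) \<and> (\<exists>i\<le>n. v i \<noteq> 0)}"

definition proportional :: "nat \<Rightarrow> ((nat \<Rightarrow> 'a::field) \<times> (nat \<Rightarrow> 'a)) set" where
  "proportional n = {(u, v). u \<in> nonzero_vectors n \<and> v \<in> nonzero_vectors n \<and>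
     (\<exists>c. c \<noteq> 0 \<and> v = (\<lambda>i. c * u i))}"

definition proj_space :: "nat \<Rightarrow> (nat \<Rightarrow> 'a::field) set set" where
  "proj_space n = nonzero_vectors n // proportional n"

definition zero_locus :: "nat \<Rightarrow> 'a::field mpoly \<Rightarrow> (nat \<Rightarrow> 'a) set set" where
  "zero_locus n F = {P \<in> proj_space n. \<forall>v\<in>P. poly_eval F v = 0}"

definition no_common_hyperplane :: "nat \<Rightarrow> 'a::field mpoly \<Rightarrow> 'a mpoly \<Rightarrow> bool" where
  "no_common_hyperplane n F G \<longleftrightarrow>
     \<not> (\<exists>L. L \<noteq> 0 \<and> is_form n 1 L \<and> L dvd F \<and> L dvd G)"

text \<open>
  Two quadrics are understood to be distinct, in the weak sense that their equations are not
  scalar multiples of each other. Without this, an irreducible \<open>F\<close> paired with itself would have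
  no common linear factor, and \<open>Z(F)\<close> can have more than \<open>4 q\<^bsup>n-2\<^esup> + \<pi>\<^bsub>n-3\<^esub>\<close> points.
  \<open>Poly_Mapping.single 0 c\<close> is the constant polynomial \<open>c\<close>.
\<close>

definition same_equation :: "'a::field mpoly \<Rightarrow> 'a mpoly \<Rightarrow> bool" where
  "same_equation F G \<longleftrightarrow> (\<exists>c. c \<noteq> 0 \<and> G = Poly_Mapping.single 0 c * F)"

definition proj_count :: "nat \<Rightarrow> nat \<Rightarrow> nat" where
  "proj_count q m = (\<Sum>i\<le>m. q ^ i)"

end

(* Let N(Q) be the number of zeros of a quadratic form Q on a finite space V over a field of q elements.
   Counting along the lines parallel to a singular vector e outside the radical gives
   N(Q) = |V|/q - |V|/q^2 + N(Q | e-perp), whence N(Q) <= |V| (2/q - 1/q^2) if Q is nonzero, and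
   N(Q) <= |V| (1/q + 1/q^2 - 1/q^3) if Q vanishes on no hyperplane.
   If no member of the pencil spanned by the two quadrics vanishes on a hyperplane, the second bound
   is summed over the q + 1 members; a common zero is counted q + 1 times, any other vector once.
   Otherwise one may take the first quadric to be a pair of hyperplanes H, H', and inclusion-exclusion
   applies to the second quadric on H and H': either it is irreducible on both, or it vanishes on a
   hyperplane of one of them, which makes its zero set on the intersection of H and H' large.
   Equality holds for the cone over the four points of the plane given by
   x0 (x0 - x2) = x1 (x1 - x2) = 0. *)

theory Submission
  imports Defs Complex_Main "HOL-Library.Function_Algebras"
begin

section \<open>Zeros of quadratic forms on finite vector spaces\<close>

definition polar :: "('b::plus \<Rightarrow> 'a::minus) \<Rightarrow> 'b \<Rightarrow> 'b \<Rightarrow> 'a" where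
  "polar Q u v = Q (u + v) - Q u - Q v"

text \<open>\<open>q\<close> is a real number so that counts can be written with quotients such as
  \<open>card V / q\<close>. The type \<open>'b\<close> may be infinite; counting takes place inside
  a finite subspace \<open>V\<close>.\<close>

locale finite_field_space = vector_space scale
  for scale :: "'a::{field, finite} \<Rightarrow> 'b::ab_group_add \<Rightarrow> 'b" (infixr "*s" 75) +
  fixes q :: real
  assumes q_eq: "q = CARD('a)"
begin

text \<open>This form of the axioms is meaningful in every characteristic, including 2. Linearity of
  the polar form in its second argument follows from symmetry.\<close>

definition quadratic :: "('b \<Rightarrow> 'a) \<Rightarrow> bool" where
  "quadratic Q \<longleftrightarrow> (\<forall>c v. Q (c *s v) = c\<^sup>2 * Q v) \<and>
     (\<forall>u v w. polar Q (u + v) w = polar Q u w + polar Q v w) \<and>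
     (\<forall>c u w. polar Q (c *s u) w = c * polar Q u w)"

definition functional_on :: "'b set \<Rightarrow> ('b \<Rightarrow> 'a) \<Rightarrow> bool" where
  "functional_on V L \<longleftrightarrow> (\<forall>u\<in>V. \<forall>v\<in>V. L (u + v) = L u + L v) \<and> (\<forall>c. \<forall>v\<in>V. L (c *s v) = c * L v)"

text \<open>The notion is relative to \<open>V\<close>: the functional has to be linear only there,
  which also covers hyperplanes of hyperplanes.\<close>

definition hyperplane :: "'b set \<Rightarrow> 'b set \<Rightarrow> bool" where
  "hyperplane V H \<longleftrightarrow> (\<exists>L. functional_on V L \<and> (\<exists>e\<in>V. L e \<noteq> 0) \<and> H = {v\<in>V. L v = 0})"

lemma q_ge_2: "q \<ge> 2"
proof -
  have "card {0, 1 :: 'a} \<le> CARD('a)" by (intro card_mono) auto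
  then show ?thesis by (simp add: q_eq)
qed

lemma polar_commute: "polar Q u v = polar Q v u"
  for Q :: "'b \<Rightarrow> 'a"
  by (simp add: polar_def add.commute)

lemma
  assumes "quadratic Q"
  shows quadratic_scale: "Q (c *s v) = c\<^sup>2 * Q v"
    and polar_scale_left: "polar Q (c *s u) w = c * polar Q u w"
    and polar_add_right: "polar Q w (u + v) = polar Q w u + polar Q w v"
    and polar_scale_right: "polar Q w (c *s u) = c * polar Q w u"
  using assms by (auto simp: quadratic_def polar_commute[of Q w])

lemma quadratic_add: "Q (u + v) = Q u + Q v + polar Q u v"
  for Q :: "'b \<Rightarrow> 'a"
  by (simp add: polar_def)

lemma quadratic_zero: "quadratic Q \<Longrightarrow> Q 0 = 0"
  using quadratic_scale[of Q 0 0] by simp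

lemma polar_self: "quadratic Q \<Longrightarrow> polar Q e e = 2 * Q e"
  using quadratic_scale[of Q 2 e] quadratic_add[of Q e e] scale_left_distrib[of 1 1 e]
  by (simp add: power2_eq_square)

lemma quadratic_linear_combination:
  assumes "quadratic Q" "quadratic R"
  shows "quadratic (\<lambda>v. a * Q v + b * R v)"
proof -
  have "polar (\<lambda>v. a * Q v + b * R v) u v = a * polar Q u v + b * polar R u v" for u v
    by (simp add: polar_def algebra_simps)
  then show ?thesis
    using assms unfolding quadratic_def by (simp add: algebra_simps)
qed

section \<open>Linear functionals, hyperplanes and cardinalities of subspaces\<close>

lemma functional_on_subset: "functional_on V L \<Longrightarrow> W \<subseteq> V \<Longrightarrow> functional_on W L"
  unfolding functional_on_def by (meson subsetD)

lemma functional_on_polar: "quadratic Q \<Longrightarrow> functional_on V (polar Q e)"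
  by (simp add: functional_on_def polar_add_right polar_scale_right)

lemma functional_on_diff:
  assumes "functional_on V L" "subspace V" "u \<in> V" "v \<in> V"
  shows "L (u - c *s v) = L u - c * L v"
proof -
  have "L (u + (- c) *s v) = L u + (- c) * L v"
    using assms by (metis functional_on_def subspace_scale)
  then show ?thesis by simp
qed

lemma subspace_hyperplane:
  assumes "subspace V" "hyperplane V H"
  shows "subspace H"
proof -
  obtain L where L: "functional_on V L" and H: "H = {v\<in>V. L v = 0}"
    using assms(2) by (auto simp: hyperplane_def)
  have "L (0 *s 0) = 0 * L 0"
    using L subspace_0[OF assms(1)] unfolding functional_on_def by blast
  then have "L 0 = 0" by simp
  then show ?thesis
    using L assms(1) by (auto simp: H subspace_def functional_on_def)
qed

lemma hyperplane_subset: "hyperplane V H \<Longrightarrow> H \<subseteq> V"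
  by (auto simp: hyperplane_def)

text \<open>If a vector had two decompositions with different coefficients of \<open>e\<close>, one
  could solve for \<open>e\<close> and find it in \<open>W\<close>.\<close>

lemma bij_betw_add_line:
  assumes "subspace W" "e \<notin> W"
  shows "bij_betw (\<lambda>(w, t). w + t *s e) (W \<times> UNIV) {w + t *s e | w t. w \<in> W}"
proof -
  have "inj_on (\<lambda>(w, t). w + t *s e) (W \<times> UNIV)"
  proof (rule inj_onI, clarify)
    fix w w' t t' assume ww: "w \<in> W" "w' \<in> W" and eq: "w + t *s e = w' + t' *s e"
    have d: "(t - t') *s e = w' - w"
      using eq by (simp add: scale_left_diff_distrib algebra_simps)
    have "t = t'"
    proof (rule ccontr)
      assume "t \<noteq> t'"
      then have "e = inverse (t - t') *s (w' - w)" by (simp flip: d)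
      then show False
        using ww assms by (metis subspace_diff subspace_scale)
    qed
    then show "w = w' \<and> t = t'" using eq by simp
  qed
  then show ?thesis by (auto simp: bij_betw_def image_def)
qed

lemma card_add_line:
  assumes "subspace W" "e \<notin> W"
  shows "real (card {w + t *s e | w t. w \<in> W}) = q * card W"
  using arg_cong[OF bij_betw_same_card[OF bij_betw_add_line[OF assms]], of real]
  by (simp add: card_cartesian_product mult.commute q_eq)

lemma subspace_add_line:
  assumes "subspace W"
  shows "subspace {w + t *s e | w t. w \<in> W}"
proof (rule subspaceI; (elim CollectE exE conjE)?; intro CollectI)
  show "\<exists>w t. 0 = w + t *s e \<and> w \<in> W"
    by (rule exI[of _ 0], rule exI[of _ 0]) (simp add: subspace_0[OF assms])
next
  fix x y w w' t t' assume "x = w + t *s e" "w \<in> W" "y = w' + t' *s e" "w' \<in> W"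
  then show "\<exists>w'' t''. x + y = w'' + t'' *s e \<and> w'' \<in> W"
    by (intro exI[of _ "w + w'"] exI[of _ "t + t'"])
       (simp add: subspace_add[OF assms] scale_left_distrib algebra_simps)
next
  fix c x w t assume "x = w + t *s e" "w \<in> W"
  then show "\<exists>w' t'. c *s x = w' + t' *s e \<and> w' \<in> W"
    by (intro exI[of _ "c *s w"] exI[of _ "c * t"])
       (simp add: subspace_scale[OF assms] scale_right_distrib)
qed

text \<open>The coordinate along \<open>e\<close> is a linear functional with kernel
  \<open>W\<close>.\<close>

lemma hyperplane_add_line:
  assumes "subspace W" "e \<notin> W"
  shows "hyperplane {w + t *s e | w t. w \<in> W} W"
proof -
  \<comment> \<open>Since \<open>e \<notin> W\<close>, this \<open>t\<close> is unique on the span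
    of \<open>W\<close> and \<open>e\<close>, the only place where \<open>functional_on\<close>
    constrains \<open>L\<close>.\<close>
  define L where "L v = (THE t. v - t *s e \<in> W)" for v
  have L: "L (w + t *s e) = t" if "w \<in> W" for w t
    unfolding L_def
  proof (rule the_equality)
    show "w + t *s e - t *s e \<in> W" using that by simp
    fix s assume *: "w + t *s e - s *s e \<in> W"
    have inj: "inj_on (\<lambda>(w, t). w + t *s e) (W \<times> UNIV)"
      using bij_betw_add_line[OF assms] by (simp add: bij_betw_def)
    show "s = t"
      using inj_onD[OF inj, of "(w + t *s e - s *s e, s)" "(w, t)"] * that by simp
  qed
  have "functional_on {w + t *s e | w t. w \<in> W} L"
    unfolding functional_on_def
  proof (intro conjI ballI allI; clarify)
    fix w w' t t' assume "w \<in> W" "w' \<in> W"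
    then show "L (w + t *s e + (w' + t' *s e)) = L (w + t *s e) + L (w' + t' *s e)"
      using L[of "w + w'" "t + t'"] subspace_add[OF assms(1)]
      by (simp add: L scale_left_distrib algebra_simps)
  next
    fix c w t assume "w \<in> W"
    then show "L (c *s (w + t *s e)) = c * L (w + t *s e)"
      using L[of "c *s w" "c * t"] subspace_scale[OF assms(1)]
      by (simp add: L scale_right_distrib)
  qed
  moreover have "L e \<noteq> 0"
    using L[of 0 1] subspace_0[OF assms(1)] by simp
  moreover have "e \<in> {w + t *s e | w t. w \<in> W}"
    using subspace_0[OF assms(1)] by (auto intro!: exI[of _ 0] exI[of _ 1])
  moreover have "W = {v \<in> {w + t *s e | w t. w \<in> W}. L v = 0}"
  proof (intro subset_antisym subsetI)
    fix w assume "w \<in> W"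
    then show "w \<in> {v \<in> {w + t *s e | w t. w \<in> W}. L v = 0}"
      using L[of w 0] by (fastforce intro: exI[of _ w] exI[of _ 0])
  qed (use L in auto)
  ultimately show ?thesis
    unfolding hyperplane_def by blast
qed

text \<open>Subtracting \<open>L v / L e\<close> times \<open>e\<close> from \<open>v\<close> gives
  a vector in the kernel of \<open>L\<close>.\<close>

lemma hyperplane_eq_add_line:
  assumes "subspace V" "hyperplane V H"
  obtains e where "e \<in> V" "e \<notin> H" "V = {w + t *s e | w t. w \<in> H}"
proof -
  obtain L e where L: "functional_on V L" and e: "e \<in> V" "L e \<noteq> 0" and H: "H = {v\<in>V. L v = 0}"
    using assms(2) by (auto simp: hyperplane_def)
  have "\<exists>w t. v = w + t *s e \<and> w \<in> H" if "v \<in> V" for v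
    using that e assms(1) functional_on_diff[OF L assms(1) that e(1), of "L v / L e"]
    by (intro exI[of _ "v - (L v / L e) *s e"] exI[of _ "L v / L e"])
       (auto simp: H subspace_diff subspace_scale)
  then have "V = {w + t *s e | w t. w \<in> H}"
    using e assms(1) by (auto simp: H subspace_add subspace_scale)
  then show ?thesis using e by (intro that[of e]) (simp_all add: H)
qed

lemma card_hyperplane:
  assumes "subspace V" "hyperplane V H"
  shows "real (card V) = q * card H"
proof -
  obtain e where "e \<notin> H" and V: "V = {w + t *s e | w t. w \<in> H}"
    by (rule hyperplane_eq_add_line[OF assms])
  then show ?thesis
    by (subst V) (rule card_add_line[OF subspace_hyperplane[OF assms]])
qed

text \<open>Adjoining a vector of \<open>V\<close> outside \<open>W\<close> multiplies the
  cardinality by \<open>q\<close>. The enlarged space \<open>U\<close> has \<open>W\<close> as a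
  hyperplane, so if \<open>W\<close> is not a hyperplane of \<open>V\<close>, then \<open>U\<close>
  is still proper and a second vector can be adjoined.\<close>

lemma card_proper_subspace:
  assumes "finite V" "subspace V" "subspace W" "W \<subset> V"
  shows "q * card W \<le> card V"
    and "\<not> hyperplane V W \<Longrightarrow> q\<^sup>2 * card W \<le> card V"
proof -
  obtain e where e: "e \<in> V" "e \<notin> W" using assms(4) by auto
  define U where "U = {w + t *s e | w t. w \<in> W}"
  have UV: "U \<subseteq> V"
    using e assms by (auto simp: U_def subspace_add subspace_scale)
  have U: "subspace U" "real (card U) = q * card W" "hyperplane U W"
    using subspace_add_line card_add_line hyperplane_add_line assms(3) e(2) by (simp_all add: U_def)
  show "q * card W \<le> card V"
    using U(2) card_mono[OF assms(1) UV] by linarith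
  show "q\<^sup>2 * card W \<le> card V" if "\<not> hyperplane V W"
  proof -
    have "U \<noteq> V" using U that by auto
    then obtain f where f: "f \<in> V" "f \<notin> U" using UV by auto
    have "{w + t *s f | w t. w \<in> U} \<subseteq> V"
      using f UV assms(2) by (auto intro!: subspace_add subspace_scale)
    then show ?thesis
      using card_add_line[OF U(1) f(2)] U(2) card_mono[OF assms(1), of "{w + t *s f | w t. w \<in> U}"]
      by (simp add: power2_eq_square mult.assoc)
  qed
qed

text \<open>Restricting the functional of \<open>H\<close> to \<open>K\<close> gives either zero or
  a functional whose kernel \<open>K \<inter> H\<close> is a hyperplane of \<open>K\<close>.\<close>

lemma card_Int_hyperplane_ge:
  assumes "finite V" "subspace V" "hyperplane V H" "subspace K" "K \<subseteq> V"
  shows "card K \<le> q * card (K \<inter> H)"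
proof (cases "K \<subseteq> H")
  case True
  then have "K \<inter> H = K" by auto
  then show ?thesis using q_ge_2 mult_right_mono[of 1 q "card K"] by simp
next
  case False
  obtain L where L: "functional_on V L" and H: "H = {v\<in>V. L v = 0}"
    using assms(3) by (auto simp: hyperplane_def)
  have "hyperplane K (K \<inter> H)"
    unfolding hyperplane_def using False assms(5) functional_on_subset[OF L assms(5)]
    by (intro exI[of _ L]) (auto simp: H)
  then show ?thesis using card_hyperplane assms(4) by fastforce
qed

section \<open>Counting the zeros of one quadratic form\<close>

definition zeros :: "('b \<Rightarrow> 'a) \<Rightarrow> 'b set \<Rightarrow> 'b set" where
  "zeros Q V = {v\<in>V. Q v = 0}"

lemma finite_zeros [simp]: "finite V \<Longrightarrow> finite (zeros Q V)"
  by (simp add: zeros_def)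

text \<open>
  A line parallel to a singular vector \<open>e\<close> meets the quadric exactly once, unless it lies in the
  hyperplane polar to \<open>e\<close>.
\<close>

lemma card_zeros_singular_vector:
  assumes "finite V" "subspace V" and Q: "quadratic Q" and "e \<in> V" "Q e = 0" "f \<in> V" "polar Q e f \<noteq> 0"
  defines "H \<equiv> {v\<in>V. polar Q e v = 0}"
  shows "hyperplane V H"
    and "card (zeros Q V) = card V / q - card V / q\<^sup>2 + card (zeros Q H)"
proof -
  show hyp: "hyperplane V H"
    unfolding hyperplane_def H_def using assms functional_on_polar by blast
  define Z where "Z = {v \<in> V. polar Q e v \<noteq> 0 \<and> Q v = 0}"
  \<comment> \<open>Thus \<open>e\<close> lies in its own polar hyperplane, and translation along
    \<open>e\<close> preserves both \<open>H\<close> and its complement.\<close>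
  have pe: "polar Q e e = 0" using polar_self assms by simp
  \<comment> \<open>On a line parallel to \<open>e\<close> the form is affine in the parameter, with
    constant slope \<open>polar Q e v\<close>.\<close>
  have shift: "Q (v + t *s e) = Q v + t * polar Q e v" "polar Q e (v + t *s e) = polar Q e v" for v t
    using assms(5) pe
    by (simp_all add: quadratic_add[of Q] quadratic_scale[OF Q] polar_scale_right[OF Q]
        polar_add_right[OF Q] polar_commute[of Q v])
  \<comment> \<open>Off \<open>H\<close> the slope is nonzero, so each line carries a unique zero; a
    vector corresponds to the zero on its line together with its offset from that zero.\<close>
  have "bij_betw (\<lambda>(v, t). v + t *s e) (Z \<times> UNIV) (V - H)"
  proof (rule bij_betw_byWitness[where f' = "\<lambda>v. (v - (Q v / polar Q e v) *s e, Q v / polar Q e v)"])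
    show "\<forall>a\<in>Z \<times> UNIV. (\<lambda>v. (v - (Q v / polar Q e v) *s e, Q v / polar Q e v))
            (case a of (v, t) \<Rightarrow> v + t *s e) = a"
      by (auto simp: Z_def shift)
    show "\<forall>v\<in>V - H. (case (v - (Q v / polar Q e v) *s e, Q v / polar Q e v) of
            (v, t) \<Rightarrow> v + t *s e) = v"
      by simp
    show "(\<lambda>(v, t). v + t *s e) ` (Z \<times> UNIV) \<subseteq> V - H"
      using assms(2,4) by (auto simp: Z_def H_def shift intro!: subspace_add subspace_scale)
    have "v - (Q v / polar Q e v) *s e \<in> Z" if "v \<in> V - H" for v
      using that assms(2,4) shift[of v "- (Q v / polar Q e v)"]
      by (auto simp: Z_def H_def intro!: subspace_diff subspace_scale)
    then show "(\<lambda>v. (v - (Q v / polar Q e v) *s e, Q v / polar Q e v)) ` (V - H) \<subseteq> Z \<times> UNIV"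
      by auto
  qed
  from bij_betw_same_card[OF this] have "card Z * q = card (V - H)"
    by (simp add: card_cartesian_product q_eq flip: of_nat_mult)
  moreover have "real (card (V - H)) = card V - card V / q"
    using card_hyperplane[OF assms(2) hyp] hyperplane_subset[OF hyp] assms(1) q_ge_2
    by (simp add: card_Diff_subset finite_subset of_nat_diff card_mono)
  ultimately have "real (card Z) * q = card V - card V / q"
    by simp
  then have "real (card Z) = card V / q - card V / q\<^sup>2"
    using q_ge_2 by (simp add: field_simps power2_eq_square)
  moreover have "zeros Q V = Z \<union> zeros Q H" "Z \<inter> zeros Q H = {}"
    by (auto simp: zeros_def Z_def H_def)
  ultimately show "card (zeros Q V) = card V / q - card V / q\<^sup>2 + card (zeros Q H)"
    using assms(1) by (simp add: card_Un_disjoint Z_def H_def)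
qed

text \<open>If every singular vector is orthogonal to all of \<open>V\<close>, then \<open>Q\<close>
  is additive on singular vectors.\<close>

lemma subspace_zeros:
  assumes "subspace V" and Q: "quadratic Q" and polar: "\<And>e f. e \<in> V \<Longrightarrow> Q e = 0 \<Longrightarrow> f \<in> V \<Longrightarrow> polar Q e f = 0"
  shows "subspace (zeros Q V)"
proof (rule subspaceI)
  show "0 \<in> zeros Q V"
    using subspace_0[OF assms(1)] quadratic_zero[OF Q] by (simp add: zeros_def)
  show "u + v \<in> zeros Q V" if "u \<in> zeros Q V" "v \<in> zeros Q V" for u v
    using that polar[of u v] subspace_add[OF assms(1)] quadratic_add[of Q u v]
    by (simp add: zeros_def)
  show "c *s v \<in> zeros Q V" if "v \<in> zeros Q V" for c v
    using that subspace_scale[OF assms(1)] quadratic_scale[OF Q] by (simp add: zeros_def)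
qed

text \<open>The bound is the size of the union of two distinct hyperplanes. With a singular vector
  outside the radical, the line count is used with the trivial estimate on \<open>H\<close>; without
  one, the zeros form a proper subspace.\<close>

lemma card_zeros_le:
  assumes "finite V" "subspace V" "quadratic Q" "v \<in> V" "Q v \<noteq> 0"
  shows "card (zeros Q V) \<le> card V * (2 / q - 1 / q\<^sup>2)"
proof (cases "\<exists>e\<in>V. \<exists>f\<in>V. Q e = 0 \<and> polar Q e f \<noteq> 0")
  case True
  then obtain e f where ef: "e \<in> V" "Q e = 0" "f \<in> V" "polar Q e f \<noteq> 0" by auto
  note C = card_zeros_singular_vector[OF assms(1-3) ef]
  define H where "H = {v\<in>V. polar Q e v = 0}"
  have "real (card (zeros Q H)) \<le> card H"
    using assms(1) by (auto simp: zeros_def H_def intro!: card_mono)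
  also have "\<dots> = card V / q"
    using card_hyperplane[OF assms(2) C(1)] q_ge_2 by (simp add: H_def)
  finally show ?thesis using C(2) by (simp add: H_def algebra_simps)
next
  case False
  have "subspace (zeros Q V)" by (rule subspace_zeros) (use False assms in auto)
  moreover have "zeros Q V \<subset> V" using assms by (auto simp: zeros_def)
  ultimately have "q * card (zeros Q V) \<le> card V"
    using card_proper_subspace assms by blast
  then have "card (zeros Q V) \<le> card V * (1 / q)" using q_ge_2 by (simp add: field_simps)
  also have "\<dots> \<le> card V * (2 / q - 1 / q\<^sup>2)"
    using q_ge_2 by (intro mult_left_mono) (simp_all add: field_simps power2_eq_square)
  finally show ?thesis .
qed

text \<open>The same dichotomy gains in both cases: \<open>Q\<close> does not vanish on the polar
  hyperplane, so \<open>card_zeros_le\<close> applies there, and a subspace of zeros is not a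
  hyperplane, which costs another factor \<open>q\<close>. The proportion is that of the hyperbolic
  quadric in dimension four, with \<open>q ^ 3 + q ^ 2 - q\<close> zeros.\<close>

lemma card_zeros_le_irreducible:
  assumes "finite V" "subspace V" "quadratic Q" "v \<in> V" "Q v \<noteq> 0"
    and irr: "\<And>H. hyperplane V H \<Longrightarrow> \<exists>w\<in>H. Q w \<noteq> 0"
  shows "card (zeros Q V) \<le> card V * (1 / q + 1 / q\<^sup>2 - 1 / q ^ 3)"
proof (cases "\<exists>e\<in>V. \<exists>f\<in>V. Q e = 0 \<and> polar Q e f \<noteq> 0")
  case True
  then obtain e f where ef: "e \<in> V" "Q e = 0" "f \<in> V" "polar Q e f \<noteq> 0" by auto
  note C = card_zeros_singular_vector[OF assms(1-3) ef]
  define H where "H = {v\<in>V. polar Q e v = 0}"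
  have H: "hyperplane V H" using C(1) by (simp add: H_def)
  obtain w where w: "w \<in> H" "Q w \<noteq> 0" using irr[OF H] by auto
  have "finite H" using assms(1) by (simp add: H_def)
  then have "card (zeros Q H) \<le> card H * (2 / q - 1 / q\<^sup>2)"
    using card_zeros_le[OF _ subspace_hyperplane[OF assms(2) H] assms(3) w] by simp
  also have "real (card H) = card V / q"
    using card_hyperplane[OF assms(2) H] q_ge_2 by simp
  finally have "card (zeros Q V) \<le> card V / q - card V / q\<^sup>2 + card V / q * (2 / q - 1 / q\<^sup>2)"
    using C(2) by (simp add: H_def)
  also have "\<dots> = card V * (1 / q + 1 / q\<^sup>2 - 1 / q ^ 3)"
    using q_ge_2 by (simp add: field_simps power2_eq_square power3_eq_cube)
  finally show ?thesis .
next
  case False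
  have "subspace (zeros Q V)" by (rule subspace_zeros) (use False assms in auto)
  moreover have "zeros Q V \<subset> V" using assms by (auto simp: zeros_def)
  moreover have "\<not> hyperplane V (zeros Q V)" using irr by (auto simp: zeros_def)
  ultimately have "q\<^sup>2 * card (zeros Q V) \<le> card V"
    using card_proper_subspace assms by blast
  then have "card (zeros Q V) \<le> card V * (1 / q\<^sup>2)" using q_ge_2 by (simp add: field_simps)
  also have "\<dots> \<le> card V * (1 / q + 1 / q\<^sup>2 - 1 / q ^ 3)"
    using q_ge_2 mult_mono[of 1 q 1 q]
    by (intro mult_left_mono) (simp_all add: field_simps power3_eq_cube)
  finally show ?thesis .
qed

section \<open>Common zeros of two quadratic forms\<close>

text \<open>Write \<open>v = t e + w\<close> with \<open>L w = 0\<close> and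
  \<open>t = L v / L e\<close>. As \<open>Q w = 0\<close>, the value \<open>Q v\<close> is
  \<open>t\<close> times \<open>polar Q e v - t * Q e\<close>, which is linear in \<open>v\<close>;
  dividing by \<open>L e\<close> gives \<open>M\<close>. No division by 2 occurs.\<close>

lemma quadratic_factor:
  assumes "subspace V" and Q: "quadratic Q" and "functional_on V L" "e \<in> V" "L e \<noteq> 0"
    and van: "\<And>v. v \<in> V \<Longrightarrow> L v = 0 \<Longrightarrow> Q v = 0"
  obtains M where "functional_on V M" "\<And>v. v \<in> V \<Longrightarrow> Q v = L v * M v"
proof -
  define M where "M v = polar Q e v / L e - Q e * L v / (L e)\<^sup>2" for v
  have "M (u + v) = M u + M v" if "u \<in> V" "v \<in> V" for u v
  proof -
    have "L (u + v) = L u + L v" using that assms(3) by (auto simp: functional_on_def)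
    then show ?thesis
      unfolding M_def polar_add_right[OF Q] by (simp add: algebra_simps add_divide_distrib)
  qed
  moreover have "M (c *s v) = c * M v" if "v \<in> V" for c v
  proof -
    have "L (c *s v) = c * L v" using that assms(3) by (auto simp: functional_on_def)
    then show ?thesis
      unfolding M_def polar_scale_right[OF Q] by (simp add: algebra_simps)
  qed
  ultimately have "functional_on V M"
    unfolding functional_on_def by blast
  moreover have "Q v = L v * M v" if v: "v \<in> V" for v
  proof -
    define t where "t = L v / L e"
    define w where "w = v - t *s e"
    have "w \<in> V" using v assms by (simp add: w_def subspace_diff subspace_scale)
    moreover have "L w = 0"
      using functional_on_diff[OF assms(3,1) v assms(4), of t] assms(5) by (simp add: w_def t_def)
    ultimately have "Q w = 0" by (rule van)
    have veq: "v = t *s e + w" by (simp add: w_def)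
    have "Q v = t\<^sup>2 * Q e + t * polar Q e w"
      unfolding veq using \<open>Q w = 0\<close>
      by (simp add: quadratic_add[of Q] quadratic_scale[OF Q] polar_scale_left[OF Q])
    moreover have "polar Q e v = t * (2 * Q e) + polar Q e w"
      unfolding veq
      by (simp add: polar_add_right[OF Q] polar_scale_right[OF Q] polar_self[OF Q])
    ultimately have "Q v = t * (polar Q e v - t * Q e)"
      by (simp add: algebra_simps power2_eq_square)
    also have "\<dots> = L v * M v"
      using assms(5) by (simp add: t_def M_def field_simps power2_eq_square)
    finally show ?thesis .
  qed
  ultimately show ?thesis by (rule that)
qed

text \<open>Here \<open>Q = L * M\<close>, and the common zeros are the zeros of \<open>R\<close> on
  the two hyperplanes \<open>L = 0\<close> and \<open>M = 0\<close>. By \<open>common\<close>,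
  \<open>R\<close> vanishes identically on neither.\<close>

lemma card_common_zeros_le_reducible:
  assumes V: "finite V" "subspace V" and Q: "quadratic Q" "quadratic R"
    and "hyperplane V H" "\<And>v. v \<in> H \<Longrightarrow> Q v = 0" "u \<in> V" "Q u \<noteq> 0"
    and common: "\<And>H. hyperplane V H \<Longrightarrow> \<exists>v\<in>H. Q v \<noteq> 0 \<or> R v \<noteq> 0"
  shows "card (zeros Q V \<inter> zeros R V) \<le> card V * (4 / q\<^sup>2 - 3 / q ^ 3)"
proof -
  obtain L e where L: "functional_on V L" "e \<in> V" "L e \<noteq> 0" "H = {v\<in>V. L v = 0}"
    using assms(5) by (auto simp: hyperplane_def)
  obtain M where M: "functional_on V M" "\<And>v. v \<in> V \<Longrightarrow> Q v = L v * M v"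
    using quadratic_factor[OF V(2) Q(1) L(1-3)] assms(6) L(4) by auto
  define H' where "H' = {v\<in>V. M v = 0}"
  \<comment> \<open>The vector \<open>u\<close> witnesses that \<open>M\<close> is nonzero, because
    \<open>Q u = L u * M u\<close>.\<close>
  have H': "hyperplane V H'"
    unfolding hyperplane_def H'_def using M assms(7,8) by (intro exI[of _ M]) auto
  note H = assms(5)
  have QH': "Q v = 0" if "v \<in> H'" for v using that M(2) by (simp add: H'_def)
  have fin: "finite H" "finite H'" using V(1) by (simp_all add: L(4) H'_def)
  have sub: "subspace H" "subspace H'" using subspace_hyperplane[OF V(2)] H H' by auto
  have cH: "real (card H) = card V / q" "real (card H') = card V / q"
    using card_hyperplane[OF V(2) H] card_hyperplane[OF V(2) H'] q_ge_2 by auto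
  obtain w w' where w: "w \<in> H" "R w \<noteq> 0" and w': "w' \<in> H'" "R w' \<noteq> 0"
    using common[OF H] common[OF H'] assms(6) QH' by blast
  have "zeros Q V \<inter> zeros R V = zeros R H \<union> zeros R H'"
    using M(2) by (auto simp: zeros_def L(4) H'_def)
  moreover have "zeros R H \<inter> zeros R H' = zeros R (H \<inter> H')" by (auto simp: zeros_def)
  ultimately have N: "real (card (zeros Q V \<inter> zeros R V)) =
      real (card (zeros R H)) + real (card (zeros R H')) - real (card (zeros R (H \<inter> H')))"
    using card_Un_Int[of "zeros R H" "zeros R H'"] fin by simp
  have le: "card (zeros R H) \<le> card V / q * (2 / q - 1 / q\<^sup>2)"
      "card (zeros R H') \<le> card V / q * (2 / q - 1 / q\<^sup>2)"
    using card_zeros_le[OF fin(1) sub(1) Q(2) w] card_zeros_le[OF fin(2) sub(2) Q(2) w'] cH by auto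
  \<comment> \<open>\<open>K\<close> has \<open>card V / q\<^sup>2\<close> elements and the other
    hyperplane cuts this down by at most a factor \<open>q\<close>. \<open>A\<close> and
    \<open>B\<close> stand for \<open>H\<close> and \<open>H'\<close> in either order.\<close>
  have *: "card (zeros R (H \<inter> H')) \<ge> card V / q ^ 3"
    if K: "hyperplane A K" "\<And>v. v \<in> K \<Longrightarrow> R v = 0" and A: "A = H \<and> B = H' \<or> A = H' \<and> B = H" for A B K
  proof -
    have A': "subspace A" "A \<subseteq> V" "hyperplane V B" "finite A" "real (card A) = card V / q"
      using A sub H H' hyperplane_subset fin cH by auto
    have KA: "K \<subseteq> A" using hyperplane_subset K by auto
    then have 1: "real (card K) \<le> q * card (K \<inter> B)"
      using card_Int_hyperplane_ge[OF V A'(3) subspace_hyperplane[OF A'(1) K(1)]] A'(2) by auto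
    have "card (K \<inter> B) \<le> card (zeros R (H \<inter> H'))"
      using A KA K(2) fin by (intro card_mono) (auto simp: zeros_def)
    then have "q * card (K \<inter> B) \<le> q * card (zeros R (H \<inter> H'))"
      using q_ge_2 by (intro mult_left_mono) auto
    with 1 have "real (card K) \<le> q * card (zeros R (H \<inter> H'))" by linarith
    moreover have "real (card A) = q * card K" using card_hyperplane[OF A'(1) K(1)] .
    ultimately show ?thesis using A'(5) q_ge_2
      by (simp add: field_simps power3_eq_cube)
  qed
  show ?thesis
  proof (cases "\<exists>K. (hyperplane H K \<or> hyperplane H' K) \<and> (\<forall>v\<in>K. R v = 0)")
    case True
    then have "card (zeros R (H \<inter> H')) \<ge> card V / q ^ 3" using * by blast
    then have "card (zeros Q V \<inter> zeros R V) \<le>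
        card V / q * (2 / q - 1 / q\<^sup>2) + card V / q * (2 / q - 1 / q\<^sup>2) - card V / q ^ 3"
      using N le by linarith
    also have "\<dots> = card V * (4 / q\<^sup>2 - 3 / q ^ 3)"
      using q_ge_2 by (simp add: field_simps power2_eq_square power3_eq_cube)
    finally show ?thesis .
  next
    case False
    have "card (zeros R H) \<le> card V / q * (1 / q + 1 / q\<^sup>2 - 1 / q ^ 3)"
      using card_zeros_le_irreducible[OF fin(1) sub(1) Q(2) w] False cH by auto
    moreover have "card (zeros R H') \<le> card V / q * (1 / q + 1 / q\<^sup>2 - 1 / q ^ 3)"
      using card_zeros_le_irreducible[OF fin(2) sub(2) Q(2) w'] False cH by auto
    ultimately have "card (zeros Q V \<inter> zeros R V) \<le> 2 * (card V / q * (1 / q + 1 / q\<^sup>2 - 1 / q ^ 3))"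
      using N by linarith
    also have "\<dots> = card V * (2 / q * (1 / q + 1 / q\<^sup>2 - 1 / q ^ 3))"
      by simp
    also have "\<dots> \<le> card V * (4 / q\<^sup>2 - 3 / q ^ 3)"
    proof (rule mult_left_mono)
      \<comment> \<open>This product over \<open>q ^ 4\<close> is the difference of the two bounds;
        its sign uses \<open>q \<ge> 2\<close>.\<close>
      have "0 \<le> (2 * q - 1) * (q - 2)" using q_ge_2 by simp
      then have "0 \<le> (2 * q - 1) * (q - 2) / q ^ 4" using q_ge_2 by simp
      also have "\<dots> = 4 / q\<^sup>2 - 3 / q ^ 3 - 2 / q * (1 / q + 1 / q\<^sup>2 - 1 / q ^ 3)"
        using q_ge_2 by (simp add: divide_simps) (simp add: algebra_simps eval_nat_numeral)
      finally show "2 / q * (1 / q + 1 / q\<^sup>2 - 1 / q ^ 3) \<le> 4 / q\<^sup>2 - 3 / q ^ 3" by simp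
    qed simp
    finally show ?thesis .
  qed
qed

text \<open>Double counting of pairs of a member and a zero of it. The members are
  \<open>Q + l R\<close> for \<open>l\<close> in the field, together with \<open>R\<close>, which is
  the member at infinity.\<close>

lemma sum_card_zeros_pencil:
  assumes "finite V"
  shows "(\<Sum>l\<in>UNIV. card (zeros (\<lambda>v. Q v + l * R v) V)) + card (zeros R V) =
    card V + CARD('a) * card (zeros Q V \<inter> zeros R V)"
proof -
  \<comment> \<open>For \<open>R v \<noteq> 0\<close> the condition is linear in \<open>l\<close>
    with one solution; otherwise it does not depend on \<open>l\<close>.\<close>
  have fibre: "card {l. Q v + l * R v = 0} =
      (if R v \<noteq> 0 then 1 else if Q v = 0 then CARD('a) else 0)" for v
  proof (cases "R v = 0")
    case False
    then have "{l. Q v + l * R v = 0} = {- (Q v / R v)}"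
      by (auto simp: field_simps eq_neg_iff_add_eq_0)
    with False show ?thesis by simp
  qed auto
  have "(\<Sum>l\<in>UNIV. card (zeros (\<lambda>v. Q v + l * R v) V)) = (\<Sum>v\<in>V. card {l. Q v + l * R v = 0})"
    using sum_multicount_gen[of UNIV V "\<lambda>l v. Q v + l * R v = 0" "\<lambda>v. card {l. Q v + l * R v = 0}"] assms
    by (simp add: zeros_def)
  also have "\<dots> = (\<Sum>v\<in>V. (if R v \<noteq> 0 then 1 else 0) + (if v \<in> zeros Q V \<inter> zeros R V then CARD('a) else 0))"
    unfolding fibre by (intro sum.cong) (auto simp: zeros_def)
  also have "\<dots> = card {v \<in> V. R v \<noteq> 0} + CARD('a) * card {v \<in> V. v \<in> zeros Q V \<inter> zeros R V}"
    using assms by (simp add: sum.distrib flip: sum.inter_filter)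
  also have "{v \<in> V. R v \<noteq> 0} = V - zeros R V"
    by (auto simp: zeros_def)
  also have "{v \<in> V. v \<in> zeros Q V \<inter> zeros R V} = zeros Q V \<inter> zeros R V"
    by (auto simp: zeros_def)
  finally show ?thesis
    using card_Diff_subset[of "zeros R V" V] card_mono[of V "zeros R V"] assms
    by (simp add: zeros_def)
qed

text \<open>The last two hypotheses say that no member of the pencil vanishes identically on
  \<open>V\<close>. A member vanishing on a hyperplane can take the place of \<open>Q\<close>; if
  there is none, all \<open>q + 1\<close> members satisfy the irreducible bound.\<close>

theorem card_common_zeros_le:
  assumes V: "finite V" "subspace V" and Q: "quadratic Q" "quadratic R"
    and common: "\<And>H. hyperplane V H \<Longrightarrow> \<exists>v\<in>H. Q v \<noteq> 0 \<or> R v \<noteq> 0"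
    and R0: "\<exists>v\<in>V. R v \<noteq> 0" and pencil: "\<And>l. \<exists>v\<in>V. Q v + l * R v \<noteq> 0"
  shows "card (zeros Q V \<inter> zeros R V) \<le> card V * (4 / q\<^sup>2 - 3 / q ^ 3)"
proof -
  define P where "P l = (\<lambda>v. Q v + l * R v)" for l
  have P: "quadratic (P l)" for l
    using quadratic_linear_combination[OF Q, of 1 l] by (simp add: P_def)
  have P0: "\<exists>v\<in>V. P l v \<noteq> 0" for l using pencil by (simp add: P_def)
  consider (R) H where "hyperplane V H" "\<forall>v\<in>H. R v = 0"
    | (P) H l where "hyperplane V H" "\<forall>v\<in>H. P l v = 0"
    | (irr) "\<And>H. hyperplane V H \<Longrightarrow> \<exists>w\<in>H. R w \<noteq> 0" "\<And>H l. hyperplane V H \<Longrightarrow> \<exists>w\<in>H. P l w \<noteq> 0"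
    by blast
  then show ?thesis
  proof cases
    case R
    show ?thesis
      using card_common_zeros_le_reducible[OF V Q(2,1) R(1)] R(2) R0 common
      by (metis Int_commute)
  next
    case P': (P H l)
    have "\<exists>v\<in>H. P l v \<noteq> 0 \<or> R v \<noteq> 0" if "hyperplane V H" for H
      using common[OF that] by (force simp: P_def)
    \<comment> \<open>Replacing \<open>Q\<close> by \<open>Q + l R\<close> changes neither the
      common zeros nor the hypothesis on hyperplanes.\<close>
    moreover have "zeros (P l) V \<inter> zeros R V = zeros Q V \<inter> zeros R V"
      by (auto simp: zeros_def P_def)
    ultimately show ?thesis
      using card_common_zeros_le_reducible[OF V P Q(2) P'(1)] P'(2) P0 by metis
  next
    case irr
    define b where "b = card V * (1 / q + 1 / q\<^sup>2 - 1 / q ^ 3)"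
    have "card (zeros R V) \<le> b" "\<And>l. card (zeros (P l) V) \<le> b"
      using card_zeros_le_irreducible[OF V] Q(2) P R0 P0 irr unfolding b_def by blast+
    then have "(\<Sum>l\<in>UNIV. real (card (zeros (P l) V))) + card (zeros R V) \<le> q * b + b"
      using sum_mono[of UNIV "\<lambda>l. real (card (zeros (P l) V))" "\<lambda>_. b"] by (fastforce simp: q_eq)
    then have "card V + q * card (zeros Q V \<inter> zeros R V) \<le> (q + 1) * b"
      using arg_cong[OF sum_card_zeros_pencil[OF V(1), of Q R], of real]
      by (simp add: P_def q_eq algebra_simps)
    then have "card (zeros Q V \<inter> zeros R V) \<le> ((q + 1) * b - card V) / q"
      using q_ge_2 by (simp add: field_simps)
    also have "\<dots> = card V * (((q + 1) * (1 / q + 1 / q\<^sup>2 - 1 / q ^ 3) - 1) / q)"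
      by (simp add: b_def algebra_simps diff_divide_distrib add_divide_distrib)
    also have "\<dots> \<le> card V * (4 / q\<^sup>2 - 3 / q ^ 3)"
    proof (rule mult_left_mono)
      \<comment> \<open>Averaging over the pencil gives the proportion
        \<open>2 / q\<^sup>2 - 1 / q ^ 4\<close>; this product over \<open>q ^ 4\<close> is its
        distance from the claimed bound.\<close>
      have "0 \<le> (2 * q - 1) * (q - 1)" using q_ge_2 by simp
      then have "0 \<le> (2 * q - 1) * (q - 1) / q ^ 4" using q_ge_2 by simp
      also have "\<dots> = 4 / q\<^sup>2 - 3 / q ^ 3 - ((q + 1) * (1 / q + 1 / q\<^sup>2 - 1 / q ^ 3) - 1) / q"
        using q_ge_2 by (simp add: divide_simps) (simp add: algebra_simps eval_nat_numeral)
      finally show "((q + 1) * (1 / q + 1 / q\<^sup>2 - 1 / q ^ 3) - 1) / q \<le> 4 / q\<^sup>2 - 3 / q ^ 3" by simp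
    qed simp
    finally show ?thesis .
  qed
qed

end

section \<open>Evaluation of polynomials\<close>

definition monomial_value :: "(nat \<Rightarrow> 'a::comm_semiring_1) \<Rightarrow> (nat \<Rightarrow>\<^sub>0 nat) \<Rightarrow> 'a" where
  "monomial_value v m = (\<Prod>i\<in>Poly_Mapping.keys m. v i ^ Poly_Mapping.lookup m i)"

lemma monomial_value_superset:
  assumes "finite A" "Poly_Mapping.keys m \<subseteq> A"
  shows "monomial_value v m = (\<Prod>i\<in>A. v i ^ Poly_Mapping.lookup m i)"
  unfolding monomial_value_def using assms
  by (intro prod.mono_neutral_left) (auto simp: in_keys_iff)

lemma monomial_value_add: "monomial_value v (m + m') = monomial_value v m * monomial_value v m'"
proof -
  define A where "A = Poly_Mapping.keys m \<union> Poly_Mapping.keys m'"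
  have "finite A" "Poly_Mapping.keys m \<subseteq> A" "Poly_Mapping.keys m' \<subseteq> A" "Poly_Mapping.keys (m + m') \<subseteq> A"
    using Poly_Mapping.keys_add[of m m'] by (auto simp: A_def)
  then show ?thesis
    by (simp add: monomial_value_superset lookup_add power_add prod.distrib)
qed

lemma monomial_value_single: "monomial_value v (Poly_Mapping.single i k) = v i ^ k"
  by (cases "k = 0") (simp_all add: monomial_value_def)

lemma monomial_value_zero [simp]: "monomial_value v 0 = 1"
  by (simp add: monomial_value_def)

lemma monomial_value_scale: "monomial_value (\<lambda>i. c * v i) m = c ^ monomial_degree m * monomial_value v m"
  by (simp add: monomial_value_def monomial_degree_def power_mult_distrib prod.distrib power_sum)

text \<open>A 0-1 vector kills exactly the monomials containing a variable outside its support. This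
  allows coefficients to be read off from values.\<close>

lemma monomial_value_indicator:
  "monomial_value (\<lambda>i. if i \<in> S then 1 else 0) m = (if Poly_Mapping.keys m \<subseteq> S then 1 else (0 :: 'a::comm_semiring_1))"
proof (cases "Poly_Mapping.keys m \<subseteq> S")
  case True
  then show ?thesis by (auto simp: monomial_value_def intro!: prod.neutral)
next
  case False
  then obtain i where "i \<in> Poly_Mapping.keys m" "i \<notin> S" by auto
  then have "(\<Prod>i\<in>Poly_Mapping.keys m. (if i \<in> S then 1 else 0) ^ Poly_Mapping.lookup m i) = (0 :: 'a)"
    by (intro prod_zero bexI[of _ i]) (auto simp: in_keys_iff power_0_left)
  with False show ?thesis by (simp add: monomial_value_def)
qed

lemma monomial_degree_add: "monomial_degree (m + m') = monomial_degree m + monomial_degree m'"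
proof -
  define A where "A = Poly_Mapping.keys m \<union> Poly_Mapping.keys m'"
  have "monomial_degree k = (\<Sum>i\<in>A. Poly_Mapping.lookup k i)" if "Poly_Mapping.keys k \<subseteq> A" for k
    unfolding monomial_degree_def using that
    by (intro sum.mono_neutral_left) (auto simp: in_keys_iff A_def)
  moreover have "Poly_Mapping.keys m \<subseteq> A" "Poly_Mapping.keys m' \<subseteq> A" "Poly_Mapping.keys (m + m') \<subseteq> A"
    using Poly_Mapping.keys_add[of m m'] by (auto simp: A_def)
  ultimately show ?thesis by (simp add: lookup_add sum.distrib)
qed

lemma monomial_degree_single [simp]: "monomial_degree (Poly_Mapping.single i k) = k"
  by (cases "k = 0") (simp_all add: monomial_degree_def)

lemma monomial_degree_zero [simp]: "monomial_degree 0 = 0"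
  by (simp add: monomial_degree_def)

lemma monomial_degree_eq_0_iff: "monomial_degree m = 0 \<longleftrightarrow> m = 0"
  by (auto simp: monomial_degree_def in_keys_iff poly_mapping_eqI)

lemma monomial_degree_SucE:
  assumes "monomial_degree m = Suc d"
  obtains i m' where "m = Poly_Mapping.single i 1 + m'" "monomial_degree m' = d"
proof -
  have "m \<noteq> 0" using assms by auto
  then obtain i where i: "Poly_Mapping.lookup m i \<noteq> 0" by (metis lookup_zero poly_mapping_eqI)
  \<comment> \<open>The subtraction of exponents is truncated, but loses nothing because the
    exponent of \<open>i\<close> is positive.\<close>
  have m: "m = Poly_Mapping.single i 1 + (m - Poly_Mapping.single i 1)"
    using i by (intro poly_mapping_eqI) (auto simp: lookup_add lookup_minus lookup_single when_def)
  with assms have "monomial_degree (m - Poly_Mapping.single i 1) = d"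
    using monomial_degree_add[of "Poly_Mapping.single i 1" "m - Poly_Mapping.single i 1"] by simp
  with m show ?thesis by (rule that)
qed

lemma monomial_degree_1E:
  assumes "monomial_degree m = 1"
  obtains i where "m = Poly_Mapping.single i 1"
  using assms monomial_degree_SucE[of m 0] by (auto simp: monomial_degree_eq_0_iff)

lemma monomial_degree_2E:
  assumes "monomial_degree m = 2"
  obtains i j where "m = Poly_Mapping.single i 1 + Poly_Mapping.single j 1"
  using assms monomial_degree_SucE[of m 1] monomial_degree_1E by (metis Suc_1)

lemma poly_eval_eq_sum:
  "poly_eval F v = (\<Sum>m\<in>Poly_Mapping.keys F. Poly_Mapping.lookup F m * monomial_value v m)"
  by (simp add: poly_eval_def monomial_value_def)

text \<open>\<open>A\<close> may contain monomials absent from \<open>F\<close>, and may omit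
  monomials of \<open>F\<close> that vanish at \<open>v\<close>.\<close>

lemma poly_eval_superset:
  assumes "finite A" "\<And>m. m \<in> Poly_Mapping.keys F - A \<Longrightarrow> monomial_value v m = 0"
  shows "poly_eval F v = (\<Sum>m\<in>A. Poly_Mapping.lookup F m * monomial_value v m)"
  unfolding poly_eval_eq_sum using assms
  by (intro sum.mono_neutral_cong) (auto simp: in_keys_iff)

lemma poly_eval_zero [simp]: "poly_eval 0 v = 0"
  by (simp add: poly_eval_def)

lemma poly_eval_single: "poly_eval (Poly_Mapping.single m c) v = c * monomial_value v m"
proof -
  have "poly_eval (Poly_Mapping.single m c) v =
      (\<Sum>k\<in>{m}. Poly_Mapping.lookup (Poly_Mapping.single m c) k * monomial_value v k)"
    by (rule poly_eval_superset) (auto split: if_splits)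
  then show ?thesis by simp
qed

lemma poly_eval_add: "poly_eval (F + G) v = poly_eval F v + poly_eval G v"
proof -
  define A where "A = Poly_Mapping.keys F \<union> Poly_Mapping.keys G"
  have "finite A" "Poly_Mapping.keys F \<subseteq> A" "Poly_Mapping.keys G \<subseteq> A" "Poly_Mapping.keys (F + G) \<subseteq> A"
    using Poly_Mapping.keys_add[of F G] by (auto simp: A_def)
  then have "poly_eval K v = (\<Sum>m\<in>A. Poly_Mapping.lookup K m * monomial_value v m)"
    if "K \<in> {F, G, F + G}" for K
    using that by (intro poly_eval_superset) auto
  then show ?thesis by (simp add: lookup_add algebra_simps sum.distrib)
qed

lemma poly_eval_sum: "poly_eval (\<Sum>x\<in>A. f x) v = (\<Sum>x\<in>A. poly_eval (f x) v)"
  by (induction A rule: infinite_finite_induct) (simp_all add: poly_eval_add)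

lemma poly_mapping_eq_sum_single:
  "F = (\<Sum>m\<in>Poly_Mapping.keys F. Poly_Mapping.single m (Poly_Mapping.lookup F m))"
  by (rule poly_mapping_eqI) (auto simp: lookup_sum lookup_single when_def in_keys_iff)

text \<open>Both factors are expanded into monomials, on which multiplicativity is
  \<open>monomial_value_add\<close>.\<close>

lemma poly_eval_mult:
  "poly_eval (F * G) v = poly_eval F v * poly_eval G v"
proof -
  let ?s = "\<lambda>F m. Poly_Mapping.single m (Poly_Mapping.lookup F m)"
  have "F * G = (\<Sum>m\<in>Poly_Mapping.keys F. ?s F m) * (\<Sum>m\<in>Poly_Mapping.keys G. ?s G m)"
    by (simp flip: poly_mapping_eq_sum_single)
  then have "poly_eval (F * G) v =
      (\<Sum>m\<in>Poly_Mapping.keys F. poly_eval (?s F m) v) * (\<Sum>m\<in>Poly_Mapping.keys G. poly_eval (?s G m) v)"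
    by (simp add: sum_product poly_eval_sum mult_single poly_eval_single monomial_value_add mult_ac)
  then show ?thesis
    by (simp flip: poly_eval_sum poly_mapping_eq_sum_single)
qed

lemma poly_eval_diff:
  fixes F G :: "'a::comm_ring_1 mpoly"
  shows "poly_eval (F - G) v = poly_eval F v - poly_eval G v"
  using poly_eval_add[of "F - G" G v] by simp

section \<open>Homogeneous forms of degree one and two\<close>

lemma is_form_zero: "is_form n d 0"
  by (simp add: is_form_def)

lemma is_form_add: "is_form n d F \<Longrightarrow> is_form n d G \<Longrightarrow> is_form n d (F + G)"
  using Poly_Mapping.keys_add[of F G] by (auto simp: is_form_def)

lemma is_form_diff:
  fixes F G :: "'a::comm_ring_1 mpoly"
  shows "is_form n d F \<Longrightarrow> is_form n d G \<Longrightarrow> is_form n d (F - G)"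
  using Poly_Mapping.keys_diff[of F G] unfolding is_form_def by blast

lemma is_form_sum: "(\<And>x. x \<in> A \<Longrightarrow> is_form n d (f x)) \<Longrightarrow> is_form n d (\<Sum>x\<in>A. f x)"
  by (induction A rule: infinite_finite_induct) (auto simp: is_form_add is_form_zero)

lemma is_form_mult:
  assumes "is_form n d F" "is_form n e G"
  shows "is_form n (d + e) (F * G)"
  unfolding is_form_def
proof
  fix m assume "m \<in> Poly_Mapping.keys (F * G)"
  then obtain a b where ab: "m = a + b" "a \<in> Poly_Mapping.keys F" "b \<in> Poly_Mapping.keys G"
    using keys_mult[of F G] by auto
  then show "Poly_Mapping.keys m \<subseteq> {..n} \<and> monomial_degree m = d + e"
    using assms Poly_Mapping.keys_add[of a b] unfolding is_form_def
    by (metis le_sup_iff monomial_degree_add order_trans)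
qed

lemma is_form_const: "is_form n 0 (Poly_Mapping.single 0 c)"
  by (auto simp: is_form_def)

lemma poly_eval_scale:
  assumes "is_form n d F"
  shows "poly_eval F (\<lambda>i. c * v i) = c ^ d * poly_eval F v"
proof -
  have "poly_eval F (\<lambda>i. c * v i) =
      (\<Sum>m\<in>Poly_Mapping.keys F. Poly_Mapping.lookup F m * (c ^ d * monomial_value v m))"
    using assms unfolding poly_eval_eq_sum
    by (auto simp: monomial_value_scale is_form_def intro!: sum.cong)
  also have "\<dots> = c ^ d * poly_eval F v"
    by (simp add: poly_eval_eq_sum sum_distrib_left mult_ac)
  finally show ?thesis .
qed

text \<open>The unit vectors detect the coefficients of the squares; then the sums of two unit
  vectors detect the mixed coefficients. Hence values determine a quadratic form even over the field
  with two elements.\<close>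

lemma form_2_eq_0:
  fixes F :: "'a::comm_semiring_1 mpoly"
  assumes F: "is_form n 2 F" and van: "\<And>v. (\<forall>i>n. v i = 0) \<Longrightarrow> poly_eval F v = 0"
  shows "F = 0"
proof (rule ccontr)
  let ?x = "\<lambda>i j. Poly_Mapping.single i 1 + Poly_Mapping.single j (1::nat)"
  have keys: "Poly_Mapping.keys (?x i j) = {i, j}" for i j :: nat
    by (auto simp: in_keys_iff lookup_add lookup_single when_def split: if_splits)
  \<comment> \<open>At the indicator vector of \<open>{i, j}\<close> only monomials in these two
    variables survive, and by \<open>other\<close> the sole candidate is
    \<open>x_i x_j\<close>.\<close>
  have coeff: "Poly_Mapping.lookup F (?x i j) = 0"
    if ij: "i \<le> n" "j \<le> n"
      and other: "\<And>m. m \<in> Poly_Mapping.keys F \<Longrightarrow> Poly_Mapping.keys m \<subseteq> {i, j} \<Longrightarrow> m = ?x i j" for i j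
  proof -
    define v :: "nat \<Rightarrow> 'a" where "v = (\<lambda>k. if k \<in> {i, j} then 1 else 0)"
    have v: "monomial_value v m = (if Poly_Mapping.keys m \<subseteq> {i, j} then 1 else 0)" for m
      unfolding v_def by (rule monomial_value_indicator)
    have "poly_eval F v = (\<Sum>m\<in>{?x i j}. Poly_Mapping.lookup F m * monomial_value v m)"
    proof (rule poly_eval_superset)
      fix m assume "m \<in> Poly_Mapping.keys F - {?x i j}"
      then have "\<not> Poly_Mapping.keys m \<subseteq> {i, j}" using other by blast
      then show "monomial_value v m = 0" by (simp only: v if_False)
    qed simp
    also have "\<dots> = Poly_Mapping.lookup F (?x i j)" using keys[of i j] by (simp add: v)
    finally show ?thesis using van[of v] ij by (auto simp: v_def)
  qed
  have deg2: "\<exists>i j. m = ?x i j \<and> i \<le> n \<and> j \<le> n" if "m \<in> Poly_Mapping.keys F" for m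
  proof -
    have m: "monomial_degree m = 2" "Poly_Mapping.keys m \<subseteq> {..n}"
      using F that by (auto simp: is_form_def)
    from m(1) obtain i j where ij: "m = ?x i j" by (rule monomial_degree_2E)
    then have "{i, j} \<subseteq> {..n}" using m(2) keys[of i j] by simp
    then show ?thesis using ij by blast
  qed
  have square: "Poly_Mapping.lookup F (?x i i) = 0" if "i \<le> n" for i
  proof (rule coeff[OF that that])
    fix m assume m: "m \<in> Poly_Mapping.keys F" "Poly_Mapping.keys m \<subseteq> {i, i}"
    then obtain a b where ab: "m = ?x a b" using deg2 by blast
    then have "{a, b} \<subseteq> {i, i}" using m(2) keys[of a b] by simp
    then show "m = ?x i i" using ab by simp
  qed
  assume "F \<noteq> 0"
  then obtain m where m: "m \<in> Poly_Mapping.keys F" by (metis in_keys_iff lookup_zero poly_mapping_eqI)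
  then obtain i j where ij: "m = ?x i j" "i \<le> n" "j \<le> n" using deg2 by blast
  have "Poly_Mapping.lookup F (?x i j) = 0"
  proof (rule coeff[OF ij(2,3)])
    fix m' assume m': "m' \<in> Poly_Mapping.keys F" "Poly_Mapping.keys m' \<subseteq> {i, j}"
    then obtain a b where ab: "m' = ?x a b" "a \<le> n" using deg2 by blast
    then have "{a, b} \<subseteq> {i, j}" using m'(2) keys[of a b] by simp
    \<comment> \<open>The squares are already known to have coefficient zero, so the only monomial
      left is the mixed one.\<close>
    moreover have "a \<noteq> b" using square[of a] ab m'(1) by (auto simp: in_keys_iff)
    ultimately show "m' = ?x i j" using ab by (auto simp: add.commute)
  qed
  then show False using m ij by (simp add: in_keys_iff)
qed

definition linear_form :: "nat \<Rightarrow> (nat \<Rightarrow> 'a::comm_semiring_1) \<Rightarrow> 'a mpoly" where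
  "linear_form n a = (\<Sum>i\<le>n. Poly_Mapping.single (Poly_Mapping.single i 1) (a i))"

lemma is_form_linear_form: "is_form n 1 (linear_form n a)"
  unfolding linear_form_def by (rule is_form_sum) (auto simp: is_form_def)

lemma poly_eval_linear_form: "poly_eval (linear_form n a) v = (\<Sum>i\<le>n. a i * v i)"
  by (simp add: linear_form_def poly_eval_sum poly_eval_single monomial_value_single)

lemma linear_form_cases:
  fixes L :: "'a::comm_semiring_1 mpoly"
  assumes "is_form n 1 L" "L \<noteq> 0"
  obtains a i where "i \<le> n" "a i \<noteq> 0" "\<And>v. poly_eval L v = (\<Sum>i\<le>n. a i * v i)"
proof -
  define a where "a i = Poly_Mapping.lookup L (Poly_Mapping.single i 1)" for i
  have single: "\<exists>i\<le>n. m = Poly_Mapping.single i 1" if "m \<in> Poly_Mapping.keys L" for m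
  proof -
    have m: "monomial_degree m = 1" "Poly_Mapping.keys m \<subseteq> {..n}"
      using assms(1) that by (auto simp: is_form_def)
    from m(1) obtain i where i: "m = Poly_Mapping.single i 1" by (rule monomial_degree_1E)
    then show ?thesis using m(2) by auto
  qed
  have inj: "inj_on (\<lambda>i. Poly_Mapping.single i (1::nat)) {..n}"
    by (rule inj_onI) (metis keys_single singleton_inject zero_neq_one)
  have "poly_eval L v = (\<Sum>i\<le>n. a i * v i)" for v
  proof -
    have "poly_eval L v = (\<Sum>m\<in>(\<lambda>i. Poly_Mapping.single i 1) ` {..n}.
        Poly_Mapping.lookup L m * monomial_value v m)"
      by (rule poly_eval_superset) (use single in auto)
    also have "\<dots> = (\<Sum>i\<le>n. a i * v i)"
      by (subst sum.reindex[OF inj]) (simp add: a_def monomial_value_single)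
    finally show ?thesis .
  qed
  moreover obtain m where "m \<in> Poly_Mapping.keys L"
    using assms(2) by (metis in_keys_iff lookup_zero poly_mapping_eqI)
  moreover from this obtain i where "i \<le> n" "m = Poly_Mapping.single i 1" using single by blast
  ultimately show ?thesis by (intro that[of i a]) (auto simp: a_def in_keys_iff)
qed

section \<open>Quadrics in coordinates\<close>

text \<open>The ambient space consists of all sequences; the space of dimension \<open>n + 1\<close>
  is its finite subspace \<open>coord_space {..n}\<close>.\<close>

interpretation coord: finite_field_space
  "\<lambda>c (v :: nat \<Rightarrow> 'a::{field, finite}) i. c * v i" "real CARD('a)"
  by unfold_locales (auto simp: fun_eq_iff algebra_simps)

text \<open>An arbitrary index set is allowed because the extremal example is counted after removing
  individual coordinates.\<close>

definition coord_space :: "nat set \<Rightarrow> (nat \<Rightarrow> 'a::zero) set" where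
  "coord_space S = {v. \<forall>i. i \<notin> S \<longrightarrow> v i = 0}"

lemma subspace_coord_space: "coord.subspace (coord_space S)"
  by (rule coord.subspaceI) (auto simp: coord_space_def)

lemma card_coord_space:
  assumes "finite S"
  shows "finite (coord_space S :: (nat \<Rightarrow> 'a::{field, finite}) set) \<and>
    card (coord_space S :: (nat \<Rightarrow> 'a) set) = CARD('a) ^ card S"
  using assms
proof (induction S)
  case empty
  have "coord_space {} = {0 :: nat \<Rightarrow> 'a}" by (auto simp: coord_space_def fun_eq_iff)
  then show ?case by simp
next
  case (insert a S)
  define f :: "(nat \<Rightarrow> 'a) \<times> 'a \<Rightarrow> nat \<Rightarrow> 'a" where "f = (\<lambda>(w, t). w(a := t))"
  have "bij_betw f (coord_space S \<times> UNIV) (coord_space (insert a S))"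
    by (rule bij_betw_byWitness[where f' = "\<lambda>v. (v(a := 0), v a)"])
       (use insert.hyps in \<open>auto simp: f_def coord_space_def fun_eq_iff\<close>)
  from bij_betw_finite[OF this] bij_betw_same_card[OF this] insert show ?case
    by (simp add: card_cartesian_product mult.commute)
qed

text \<open>Each monomial of degree 2 is a product of two coordinates, so the polar form is a sum of
  symmetric bilinear terms.\<close>

lemma quadratic_poly_eval:
  fixes F :: "'a::{field, finite} mpoly"
  assumes "is_form n 2 F"
  shows "coord.quadratic (poly_eval F)"
proof -
  have "\<exists>i j. \<forall>v :: nat \<Rightarrow> 'a. monomial_value v m = v i * v j" if m: "m \<in> Poly_Mapping.keys F" for m
  proof -
    have "monomial_degree m = 2" using assms m by (simp add: is_form_def)
    then obtain i j where "m = Poly_Mapping.single i 1 + Poly_Mapping.single j 1"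
      by (rule monomial_degree_2E)
    then have "\<forall>v :: nat \<Rightarrow> 'a. monomial_value v m = v i * v j"
      by (simp add: monomial_value_add monomial_value_single)
    then show ?thesis by blast
  qed
  then obtain I J where IJ: "\<And>m v. m \<in> Poly_Mapping.keys F \<Longrightarrow> monomial_value v m = v (I m) * (v (J m) :: 'a)"
    by metis
  have eval: "poly_eval F v = (\<Sum>m\<in>Poly_Mapping.keys F. Poly_Mapping.lookup F m * (v (I m) * v (J m)))" for v
    unfolding poly_eval_eq_sum by (rule sum.cong) (simp_all add: IJ)
  have polar: "polar (poly_eval F) u v = (\<Sum>m\<in>Poly_Mapping.keys F.
      Poly_Mapping.lookup F m * (u (I m) * v (J m) + v (I m) * u (J m)))" for u v
    unfolding polar_def eval by (simp add: algebra_simps sum.distrib)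
  show ?thesis
    unfolding coord.quadratic_def
  proof (intro conjI allI)
    show "poly_eval F (\<lambda>i. c * v i) = c\<^sup>2 * poly_eval F v" for c v
      by (rule poly_eval_scale[OF assms])
    show "polar (poly_eval F) (u + v) w = polar (poly_eval F) u w + polar (poly_eval F) v w" for u v w
      unfolding polar by (simp add: algebra_simps sum.distrib)
    show "polar (poly_eval F) (\<lambda>i. c * u i) w = c * polar (poly_eval F) u w" for c u w
      unfolding polar by (simp add: algebra_simps sum_distrib_left)
  qed
qed

lemma functional_on_coord_space:
  fixes L :: "(nat \<Rightarrow> 'a::{field, finite}) \<Rightarrow> 'a"
  assumes L: "coord.functional_on (coord_space {..n}) L"
  obtains a where "\<And>v. v \<in> coord_space {..n} \<Longrightarrow> L v = (\<Sum>i\<le>n. a i * v i)"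
proof -
  define e :: "nat \<Rightarrow> nat \<Rightarrow> 'a" where "e i = (\<lambda>j. if j = i then 1 else 0)" for i
  have add: "L (u + v) = L u + L v" if "u \<in> coord_space {..n}" "v \<in> coord_space {..n}" for u v
    using L that by (simp add: coord.functional_on_def)
  have scale: "L (\<lambda>i. c * v i) = c * L v" if "v \<in> coord_space {..n}" for c v
    using L that by (simp add: coord.functional_on_def)
  \<comment> \<open>Induction on the number of leading coordinates that are kept; each step adds one
    multiple of a unit vector.\<close>
  have *: "L (\<lambda>j. if j < k then v j else 0) = (\<Sum>i<k. L (e i) * v i)" if "k \<le> Suc n" for k v
    using that
  proof (induction k)
    case 0
    show ?case using scale[of 0 0] by (simp add: coord_space_def zero_fun_def)
  next
    case (Suc k)
    have "(\<lambda>j. if j < Suc k then v j else 0) = (\<lambda>j. if j < k then v j else 0) + (\<lambda>j. v k * e k j)"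
      by (auto simp: e_def fun_eq_iff less_Suc_eq)
    moreover have "e k \<in> coord_space {..n}" "(\<lambda>j. if j < k then v j else 0) \<in> coord_space {..n}"
      "(\<lambda>j. v k * e k j) \<in> coord_space {..n}"
      using Suc.prems by (auto simp: e_def coord_space_def)
    ultimately show ?case using Suc by (simp add: add scale)
  qed
  have "L v = (\<Sum>i\<le>n. L (e i) * v i)" if "v \<in> coord_space {..n}" for v
  proof -
    have "(\<lambda>j. if j < Suc n then v j else 0) = v"
      using that by (auto simp: coord_space_def fun_eq_iff)
    then show ?thesis using *[of "Suc n" v] by (simp add: lessThan_Suc_atMost)
  qed
  then show ?thesis by (rule that)
qed

text \<open>\<open>quadratic_factor\<close> gives a factorization of functions into two linear ones.
  The difference of the polynomials is a quadratic form with only zero values, hence zero by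
  \<open>form_2_eq_0\<close>.\<close>

lemma linear_form_dvd:
  fixes F :: "'a::{field, finite} mpoly"
  assumes F: "is_form n 2 F"
    and a: "v \<in> coord_space {..n}" "poly_eval (linear_form n a) v \<noteq> 0"
    and van: "\<And>v. v \<in> coord_space {..n} \<Longrightarrow> poly_eval (linear_form n a) v = 0 \<Longrightarrow> poly_eval F v = 0"
  shows "linear_form n a dvd F"
proof -
  have "coord.functional_on (coord_space {..n}) (poly_eval (linear_form n a))"
    by (simp add: coord.functional_on_def poly_eval_linear_form algebra_simps sum.distrib sum_distrib_left)
  then obtain M where M: "coord.functional_on (coord_space {..n}) M"
    "\<And>v. v \<in> coord_space {..n} \<Longrightarrow> poly_eval F v = poly_eval (linear_form n a) v * M v"
    using coord.quadratic_factor[OF subspace_coord_space quadratic_poly_eval[OF F],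
        where L = "poly_eval (linear_form n a)" and e = v] a van by blast
  obtain b where b: "\<And>v. v \<in> coord_space {..n} \<Longrightarrow> M v = (\<Sum>i\<le>n. b i * v i)"
    using functional_on_coord_space[OF M(1)] by blast
  have "F - linear_form n a * linear_form n b = 0"
  proof (rule form_2_eq_0)
    have "is_form n (1 + 1) (linear_form n a * linear_form n b)"
      by (intro is_form_mult is_form_linear_form)
    then show "is_form n 2 (F - linear_form n a * linear_form n b)"
      using F by (intro is_form_diff) (simp_all only: one_add_one)
    fix v :: "nat \<Rightarrow> 'a" assume "\<forall>i>n. v i = 0"
    then have "v \<in> coord_space {..n}" by (simp add: coord_space_def)
    then show "poly_eval (F - linear_form n a * linear_form n b) v = 0"
      by (simp add: poly_eval_diff poly_eval_mult M(2) b poly_eval_linear_form)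
  qed
  then show ?thesis by simp
qed

text \<open>If both forms vanished on \<open>H\<close>, the linear form defining \<open>H\<close>
  would divide both.\<close>

lemma nonvanishing_on_hyperplane:
  fixes F G :: "'a::{field, finite} mpoly"
  assumes "is_form n 2 F" "is_form n 2 G" "no_common_hyperplane n F G"
    and H: "coord.hyperplane (coord_space {..n}) H"
  shows "\<exists>v\<in>H. poly_eval F v \<noteq> 0 \<or> poly_eval G v \<noteq> 0"
proof (rule ccontr)
  assume contra: "\<not> ?thesis"
  obtain L e where L: "coord.functional_on (coord_space {..n}) L" "e \<in> coord_space {..n}" "L e \<noteq> 0"
      "H = {v \<in> coord_space {..n}. L v = 0}"
    using H by (auto simp: coord.hyperplane_def)
  obtain a where a: "\<And>v. v \<in> coord_space {..n} \<Longrightarrow> L v = (\<Sum>i\<le>n. a i * v i)"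
    using functional_on_coord_space[OF L(1)] by blast
  have e: "poly_eval (linear_form n a) e \<noteq> 0" using L(2,3) a by (simp add: poly_eval_linear_form)
  have van: "poly_eval F v = 0" "poly_eval G v = 0"
    if "v \<in> coord_space {..n}" "poly_eval (linear_form n a) v = 0" for v
    using that contra a by (auto simp: L(4) poly_eval_linear_form)
  have "linear_form n a dvd F" "linear_form n a dvd G"
    using linear_form_dvd[OF _ L(2) e] assms(1,2) van by blast+
  moreover have "linear_form n a \<noteq> 0" using e by auto
  ultimately show False
    using assms(3) is_form_linear_form unfolding no_common_hyperplane_def by blast
qed

text \<open>This is the bound for \<open>q ^ (n + 1)\<close> vectors, rearranged so that no
  subtraction of counts is left. Zero values on all vectors mean a zero polynomial, which translates
  the pencil hypotheses into \<open>F \<noteq> 0\<close> and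
  \<open>\<not> same_equation F G\<close>.\<close>

lemma card_common_zeros_quadrics_le:
  fixes F G :: "'a::{field, finite} mpoly"
  assumes F: "F \<noteq> 0" "is_form n 2 F" and G: "G \<noteq> 0" "is_form n 2 G"
    and "\<not> same_equation F G" "no_common_hyperplane n F G" "n \<ge> 2"
  shows "card {v \<in> coord_space {..n}. poly_eval F v = 0 \<and> poly_eval G v = 0} + 3 * CARD('a) ^ (n - 2)
    \<le> 4 * CARD('a) ^ (n - 1)"
proof -
  let ?V = "coord_space {..n} :: (nat \<Rightarrow> 'a) set" and ?q = "real CARD('a)"
  have "real (card (coord.zeros (poly_eval G) ?V \<inter> coord.zeros (poly_eval F) ?V)) \<le>
      card ?V * (4 / ?q\<^sup>2 - 3 / ?q ^ 3)"
  proof (rule coord.card_common_zeros_le)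
    show "finite ?V" using card_coord_space[of "{..n}", where 'a = 'a] by simp
    show "coord.subspace ?V" by (rule subspace_coord_space)
    show "coord.quadratic (poly_eval G)" "coord.quadratic (poly_eval F)"
      using F(2) G(2) by (auto intro: quadratic_poly_eval)
    show "\<exists>v\<in>H. poly_eval G v \<noteq> 0 \<or> poly_eval F v \<noteq> 0" if "coord.hyperplane ?V H" for H
      using nonvanishing_on_hyperplane[OF F(2) G(2) assms(6) that] by blast
    show "\<exists>v\<in>?V. poly_eval F v \<noteq> 0"
    proof (rule ccontr)
      assume "\<not> ?thesis"
      then have "F = 0" by (intro form_2_eq_0[OF F(2)]) (auto simp: coord_space_def not_le)
      then show False using F(1) by simp
    qed
    show "\<exists>v\<in>?V. poly_eval G v + l * poly_eval F v \<noteq> 0" for l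
    proof (rule ccontr)
      assume contra: "\<not> ?thesis"
      have "is_form n 2 (Poly_Mapping.single 0 (- l) * F)"
        using is_form_mult[OF is_form_const F(2)] by (simp only: add_0)
      then have "G - Poly_Mapping.single 0 (- l) * F = 0"
        using contra G(2)
        by (intro form_2_eq_0[of n] is_form_diff)
           (auto simp: poly_eval_diff poly_eval_mult poly_eval_single coord_space_def not_le)
      \<comment> \<open>Now \<open>G\<close> is \<open>- l\<close> times \<open>F\<close>, and
        \<open>G \<noteq> 0\<close> makes this a nonzero multiple.\<close>
      moreover from this have "l \<noteq> 0" using G(1) by auto
      ultimately show False
        using assms(5) unfolding same_equation_def by (metis eq_iff_diff_eq_0 neg_equal_0_iff_equal)
    qed
  qed
  also have "coord.zeros (poly_eval G) ?V \<inter> coord.zeros (poly_eval F) ?V =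
      {v \<in> ?V. poly_eval F v = 0 \<and> poly_eval G v = 0}" (is "_ = ?Z")
    by (auto simp: coord.zeros_def)
  finally have "card ?Z \<le> ?q ^ Suc n * (4 / ?q\<^sup>2 - 3 / ?q ^ 3)"
    using card_coord_space[of "{..n}", where 'a = 'a] by simp
  also have "\<dots> = 4 * ?q ^ (n - 1) - 3 * ?q ^ (n - 2)"
  proof -
    obtain k where n: "n = k + 2" using assms(7) by (metis add.commute le_Suc_ex)
    show ?thesis using coord.q_ge_2[where 'a = 'a] unfolding n
      by (simp add: field_simps eval_nat_numeral)
  qed
  finally have "real (card ?Z + 3 * CARD('a) ^ (n - 2)) \<le> real (4 * CARD('a) ^ (n - 1))"
    by simp
  then show ?thesis by linarith
qed

section \<open>From vectors to projective points\<close>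

lemma nonzero_vectors_eq: "nonzero_vectors n = coord_space {..n} - {0}"
  by (auto simp: nonzero_vectors_def coord_space_def fun_eq_iff not_le) (use not_le in blast)

lemma equiv_proportional: "equiv (nonzero_vectors n) (proportional n)"
  (is "equiv ?A ?r")
proof (rule equivI)
  show "refl_on ?A ?r"
    by (rule refl_onI) (auto simp: proportional_def intro: exI[of _ 1])
  show "?r \<subseteq> ?A \<times> ?A"
    by (auto simp: proportional_def)
  show "sym ?r"
  proof (rule symI)
    fix u v :: "nat \<Rightarrow> 'a" assume uv: "(u, v) \<in> ?r"
    then obtain c where "c \<noteq> 0" "v = (\<lambda>i. c * u i)" by (auto simp: proportional_def)
    then have "u = (\<lambda>i. inverse c * v i)" "inverse c \<noteq> 0" by (auto simp: fun_eq_iff)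
    moreover have "u \<in> ?A" "v \<in> ?A" using uv by (auto simp: proportional_def)
    ultimately show "(v, u) \<in> ?r"
      unfolding proportional_def mem_Collect_eq prod.case by (intro conjI exI[of _ "inverse c"])
  qed
  show "trans ?r"
  proof (rule transI)
    fix u v w :: "nat \<Rightarrow> 'a" assume uvw: "(u, v) \<in> ?r" "(v, w) \<in> ?r"
    then obtain c d where "c \<noteq> 0" "v = (\<lambda>i. c * u i)" "d \<noteq> 0" "w = (\<lambda>i. d * v i)"
      by (auto simp: proportional_def)
    then have "w = (\<lambda>i. (d * c) * u i)" "d * c \<noteq> 0" by (auto simp: fun_eq_iff)
    moreover have "u \<in> ?A" "w \<in> ?A" using uvw by (auto simp: proportional_def)
    ultimately show "(u, w) \<in> ?r"
      unfolding proportional_def mem_Collect_eq prod.case by (intro conjI exI[of _ "d * c"])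
  qed
qed

lemma proportional_class:
  assumes "u \<in> nonzero_vectors n"
  shows "proportional n `` {u} = (\<lambda>c i. c * u i) ` (UNIV - {0})"
  using assms by (auto simp: proportional_def nonzero_vectors_def)

lemma card_proportional_class:
  fixes u :: "nat \<Rightarrow> 'a::{field, finite}"
  assumes "u \<in> nonzero_vectors n"
  shows "card (proportional n `` {u}) = CARD('a) - 1"
proof -
  obtain i where "u i \<noteq> 0" using assms by (auto simp: nonzero_vectors_def)
  then have "inj_on (\<lambda>c i. c * u i) (UNIV - {0})"
    by (intro inj_onI) (metis mult_right_cancel)
  then show ?thesis by (simp add: proportional_class[OF assms] card_image card_Diff_subset)
qed

text \<open>The points of the intersection partition the nonzero common zeros into classes of
  \<open>q - 1\<close> vectors, since homogeneous equations hold for a whole class or for none of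
  it. The summand 1 is the zero vector.\<close>

lemma card_zero_locus_Int:
  fixes F G :: "'a::{field, finite} mpoly"
  assumes F: "is_form n 2 F" and G: "is_form n 2 G"
  shows "(CARD('a) - 1) * card (zero_locus n F \<inter> zero_locus n G) + 1 =
    card {v \<in> coord_space {..n}. poly_eval F v = 0 \<and> poly_eval G v = 0}" (is "_ = card ?Z")
proof -
  define C where "C = zero_locus n F \<inter> zero_locus n G"
  have fin: "finite ?Z" using card_coord_space[of "{..n}", where 'a = 'a] by simp
  have C: "C \<subseteq> nonzero_vectors n // proportional n"
    by (auto simp: C_def zero_locus_def proj_space_def)
  have UC: "\<Union>C = ?Z - {0}"
  proof (intro subset_antisym subsetI)
    fix v assume "v \<in> \<Union>C"
    moreover from this have "v \<in> nonzero_vectors n"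
      using C Union_quotient[OF equiv_proportional] by blast
    ultimately show "v \<in> ?Z - {0}"
      by (auto simp: C_def zero_locus_def nonzero_vectors_eq)
  next
    fix v assume v: "v \<in> ?Z - {0}"
    then have v': "v \<in> nonzero_vectors n" by (simp add: nonzero_vectors_eq)
    have "poly_eval F w = 0 \<and> poly_eval G w = 0" if "w \<in> proportional n `` {v}" for w
      using that v unfolding proportional_class[OF v']
      by (auto simp: poly_eval_scale[OF F] poly_eval_scale[OF G])
    then have "proportional n `` {v} \<in> C"
      using v' by (auto simp: C_def zero_locus_def proj_space_def intro: quotientI)
    moreover have "v \<in> proportional n `` {v}"
      using equiv_class_self[OF equiv_proportional v'] .
    ultimately show "v \<in> \<Union>C" by blast
  qed
  have "(CARD('a) - 1) * card C = card (\<Union>C)"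
  proof (rule card_partition)
    show "finite (\<Union>C)" using fin UC by simp
    then show "finite C" by (rule finite_UnionD)
    show "card c = CARD('a) - 1" if "c \<in> C" for c
      using that C card_proportional_class by (auto elim!: quotientE)
    show "c \<inter> d = {}" if "c \<in> C" "d \<in> C" "c \<noteq> d" for c d
      using that C quotient_disj[OF equiv_proportional] by blast
  qed
  moreover have "0 \<in> ?Z"
    using poly_eval_scale[OF F, of 0 0] poly_eval_scale[OF G, of 0 0]
    by (simp add: coord_space_def zero_fun_def)
  ultimately show ?thesis
    using card_Suc_Diff1[OF fin] UC by (simp add: C_def)
qed

lemma proj_count_eq: "(q - 1) * proj_count q m + 1 = q ^ Suc m" if "q \<ge> 1"
proof -
  have "int ((q - 1) * proj_count q m + 1) = int (q ^ Suc m)"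
    using sum_gp_basic[of "int q" m] that by (simp add: proj_count_def of_nat_diff algebra_simps)
  then show ?thesis by (simp only: of_nat_eq_iff)
qed

section \<open>The extremal pair of quadrics\<close>

definition split_quadric :: "nat \<Rightarrow> nat \<Rightarrow> 'a::comm_ring_1 mpoly" where
  "split_quadric i j = (let x = \<lambda>k. Poly_Mapping.single (Poly_Mapping.single k 1) 1 in x i * (x i - x j))"

lemma is_form_split_quadric:
  assumes "i \<le> n" "j \<le> n"
  shows "is_form n 2 (split_quadric i j :: 'a::comm_ring_1 mpoly)"
proof -
  have "is_form n 1 (Poly_Mapping.single (Poly_Mapping.single k 1) (1 :: 'a))" if "k \<le> n" for k
    using that by (auto simp: is_form_def)
  then have "is_form n (1 + 1) (split_quadric i j :: 'a mpoly)"
    unfolding split_quadric_def Let_def using assms by (intro is_form_mult is_form_diff) auto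
  then show ?thesis by (simp only: one_add_one)
qed

lemma poly_eval_split_quadric: "poly_eval (split_quadric i j) v = v i * (v i - v j)"
  by (simp add: split_quadric_def poly_eval_mult poly_eval_diff poly_eval_single monomial_value_single)

text \<open>Both quadrics would vanish wherever a common factor \<open>L\<close> does. Suitable
  zeros of \<open>L\<close> show that all its coefficients except possibly that of
  \<open>x_2\<close> vanish, and then the first unit vector is a zero of \<open>L\<close> off the
  first quadric.\<close>

lemma no_common_hyperplane_split_quadrics:
  assumes "n \<ge> 2"
  shows "no_common_hyperplane n (split_quadric 0 2 :: 'a::{field, finite} mpoly) (split_quadric 1 2)"
  unfolding no_common_hyperplane_def
proof
  assume "\<exists>L :: 'a mpoly. L \<noteq> 0 \<and> is_form n 1 L \<and> L dvd split_quadric 0 2 \<and> L dvd split_quadric 1 2"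
  then obtain L K M :: "'a mpoly" where L: "L \<noteq> 0" "is_form n 1 L"
    and "split_quadric 0 2 = L * K" "split_quadric 1 2 = L * M" by (auto elim!: dvdE)
  then have eval: "poly_eval L v * poly_eval K v = v 0 * (v 0 - v 2)"
      "poly_eval L v * poly_eval M v = v 1 * (v 1 - v 2)" for v
    by (metis poly_eval_mult poly_eval_split_quadric)+
  obtain a i where i: "i \<le> n" "a i \<noteq> 0" and a: "\<And>v. poly_eval L v = (\<Sum>i\<le>n. a i * v i)"
    using linear_form_cases[OF L(2,1)] by blast
  have van: "v 0 * (v 0 - v 2) = 0 \<and> v 1 * (v 1 - v 2) = 0" if "(\<Sum>i\<le>n. a i * v i) = 0" for v
    using eval[of v] that by (simp add: a)
  \<comment> \<open>Any vector becomes a zero of \<open>L\<close> after changing one coordinate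
    whose coefficient is nonzero.\<close>
  have adjust: "\<exists>t. (\<Sum>i\<le>n. a i * (w(k := t)) i) = 0" if "k \<le> n" "a k \<noteq> 0" for k w
  proof -
    have "(\<Sum>i\<le>n. a i * (w(k := t)) i) = a k * t + (\<Sum>i\<in>{..n} - {k}. a i * w i)" for t
      using that(1) by (subst sum.remove[of _ k]) (auto intro!: sum.cong)
    then show ?thesis
      using that(2) by (intro exI[of _ "- (\<Sum>i\<in>{..n} - {k}. a i * w i) / a k"]) simp
  qed
  \<comment> \<open>Changing coordinate \<open>k\<close> of the unit vector in direction 0 leaves
    \<open>v 0 = 1\<close> and \<open>v 2 = 0\<close>, so the first quadric is missed.\<close>
  have a0: "a k = 0" if k: "k \<le> n" "k \<noteq> 0" "k \<noteq> 2" for k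
  proof (rule ccontr)
    assume "a k \<noteq> 0"
    with k(1) obtain t where "(\<Sum>i\<le>n. a i * ((\<lambda>i. if i = 0 then 1 else 0)(k := t)) i) = 0"
      using adjust by blast
    from van[OF this] k(2,3) show False by simp
  qed
  \<comment> \<open>Likewise with the unit vector in direction 1, for which the second quadric is
    missed.\<close>
  have a1: "a 0 = 0"
  proof (rule ccontr)
    assume "a 0 \<noteq> 0"
    then obtain t where "(\<Sum>i\<le>n. a i * ((\<lambda>i. if i = 1 then 1 else 0)(0 := t)) i) = 0"
      using adjust by blast
    from van[OF this] show False by simp
  qed
  have "(\<Sum>k\<le>n. a k * (if k = 0 then 1 else 0)) = 0"
    using a0 a1 by (intro sum.neutral) auto
  from van[OF this] show False by simp
qed

text \<open>Once the coordinates other than 0 and 1 are fixed as \<open>w\<close>, each of the two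
  remaining ones is 0 or \<open>w 2\<close>. This gives four choices, which collapse to one when
  \<open>w 2 = 0\<close>.\<close>

lemma card_common_zeros_split_quadrics:
  assumes "n \<ge> 2"
  shows "card {v \<in> coord_space {..n}. poly_eval (split_quadric 0 2) v = (0 :: 'a::{field, finite}) \<and>
      poly_eval (split_quadric 1 2) v = 0} + 3 * CARD('a) ^ (n - 2) = 4 * CARD('a) ^ (n - 1)"
    (is "card ?Z + _ = _")
proof -
  let ?W = "coord_space ({..n} - {0, 1}) :: (nat \<Rightarrow> 'a) set"
  let ?W' = "coord_space ({..n} - {0, 1, 2}) :: (nat \<Rightarrow> 'a) set"
  have card: "card ({..n} - {0, 1}) = n - 1" "card ({..n} - {0, 1, 2}) = n - 2"
    using assms by (simp_all add: card_Diff_subset)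
  have W: "finite ?W" "card ?W = CARD('a) ^ (n - 1)" "finite ?W'" "card ?W' = CARD('a) ^ (n - 2)"
    using card_coord_space[of "{..n} - {0, 1}", where 'a = 'a]
      card_coord_space[of "{..n} - {0, 1, 2}", where 'a = 'a] card by auto
  have W': "{w \<in> ?W. w 2 = 0} = ?W'" by (auto simp: coord_space_def)
  let ?f = "\<lambda>(w, s, t). w(0 := s, 1 := t) :: nat \<Rightarrow> 'a"
  let ?g = "\<lambda>v. (v(0 := 0, 1 := 0), v 0, v 1) :: (nat \<Rightarrow> 'a) \<times> 'a \<times> 'a"
  have Z: "v \<in> ?Z \<longleftrightarrow> (\<forall>i>n. v i = 0) \<and> v 0 \<in> {0, v 2} \<and> v 1 \<in> {0, v 2}" for v
    by (auto simp: coord_space_def poly_eval_split_quadric not_le)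
  have Wiff: "w \<in> ?W \<longleftrightarrow> (\<forall>i>n. w i = 0) \<and> w 0 = 0 \<and> w 1 = 0" for w
    by (auto simp: coord_space_def not_le)
  have "bij_betw ?f (SIGMA w:?W. {0, w 2} \<times> {0, w 2}) ?Z"
  proof (rule bij_betw_byWitness[where f' = ?g])
    show "\<forall>x\<in>SIGMA w:?W. {0, w 2} \<times> {0, w 2}. ?g (?f x) = x"
      unfolding Ball_def split_paired_All mem_Sigma_iff Wiff by (auto simp: fun_eq_iff)
    show "\<forall>v\<in>?Z. ?f (?g v) = v" by (simp add: fun_eq_iff)
    have "?f (w, s, t) \<in> ?Z" if "w \<in> ?W" "s \<in> {0, w 2}" "t \<in> {0, w 2}" for w s t
      using that assms unfolding Z Wiff by simp
    then show "?f ` (SIGMA w:?W. {0, w 2} \<times> {0, w 2}) \<subseteq> ?Z" by blast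
    have "?g v \<in> (SIGMA w:?W. {0, w 2} \<times> {0, w 2})" if "v \<in> ?Z" for v
      using that unfolding Z mem_Sigma_iff Wiff by simp
    then show "?g ` ?Z \<subseteq> (SIGMA w:?W. {0, w 2} \<times> {0, w 2})" by blast
  qed
  from bij_betw_same_card[OF this] have "card ?Z = (\<Sum>w\<in>?W. card ({0, w 2} \<times> {0, w 2}))"
    using W(1) by simp
  also have "\<dots> = (\<Sum>w\<in>?W. if w 2 = 0 then 1 else 4)"
    by (intro sum.cong) (auto simp: card_cartesian_product card_insert_if)
  \<comment> \<open>Adding 3 for each \<open>w\<close> with \<open>w 2 = 0\<close> makes every fibre
    count 4.\<close>
  finally have "card ?Z + 3 * card ?W' = (\<Sum>w\<in>?W. (if w 2 = 0 then 1 else 4) + (if w 2 = 0 then 3 else 0))"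
    using W(1) by (simp only: sum.distrib flip: W') (simp flip: sum.inter_filter)
  also have "\<dots> = (\<Sum>w\<in>?W. 4)" by (intro sum.cong) auto
  finally show ?thesis using W by simp
qed

text \<open>The identity \<open>(q - 1) * proj_count q (n - 3) + 1 = q ^ (n - 2)\<close> matches the
  bound for vectors with the one for points.\<close>

lemma projective_bound_eq:
  assumes "n \<ge> 3" "q \<ge> (1::nat)"
  shows "(q - 1) * (4 * q ^ (n - 2) + proj_count q (n - 3)) + 1 + 3 * q ^ (n - 2) = 4 * q ^ (n - 1)"
proof -
  obtain m where n: "n = m + 3" using assms(1) by (metis add.commute le_Suc_ex)
  obtain r where q: "q = Suc r" using assms(2) by (cases q) auto
  show ?thesis using proj_count_eq[OF assms(2), of m] unfolding n q
    by (simp add: algebra_simps)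
qed

text \<open>Both halves reduce to counts of vectors, after which the positive factor
  \<open>q - 1\<close> is cancelled. The example has distinct zero loci, which is stronger than not
  having proportional equations.\<close>

theorem mainTheorem1:
  fixes n q :: nat
  assumes "q = CARD('a::{field, finite})" and "n \<ge> 3"
  shows "(\<forall>F\<^sub>1 F\<^sub>2 :: 'a mpoly.
            F\<^sub>1 \<noteq> 0 \<longrightarrow> is_form n 2 F\<^sub>1 \<longrightarrow> F\<^sub>2 \<noteq> 0 \<longrightarrow> is_form n 2 F\<^sub>2 \<longrightarrow>
            \<not> same_equation F\<^sub>1 F\<^sub>2 \<longrightarrow> no_common_hyperplane n F\<^sub>1 F\<^sub>2 \<longrightarrow>
            card (zero_locus n F\<^sub>1 \<inter> zero_locus n F\<^sub>2) \<le> 4 * q ^ (n - 2) + proj_count q (n - 3))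
       \<and> (\<exists>F\<^sub>1 F\<^sub>2 :: 'a mpoly.
            F\<^sub>1 \<noteq> 0 \<and> is_form n 2 F\<^sub>1 \<and> F\<^sub>2 \<noteq> 0 \<and> is_form n 2 F\<^sub>2 \<and>
            zero_locus n F\<^sub>1 \<noteq> zero_locus n F\<^sub>2 \<and> no_common_hyperplane n F\<^sub>1 F\<^sub>2 \<and>
            card (zero_locus n F\<^sub>1 \<inter> zero_locus n F\<^sub>2) = 4 * q ^ (n - 2) + proj_count q (n - 3))"
proof (intro conjI allI impI)
  have q2: "q \<ge> 2" using coord.q_ge_2[where 'a = 'a] assms(1) by simp
  define b where "b = 4 * q ^ (n - 2) + proj_count q (n - 3)"
  have b: "(q - 1) * b + 1 + 3 * q ^ (n - 2) = 4 * q ^ (n - 1)"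
    unfolding b_def by (rule projective_bound_eq) (use assms(2) q2 in auto)
  {
    fix F G :: "'a mpoly"
    assume "F \<noteq> 0" "is_form n 2 F" "G \<noteq> 0" "is_form n 2 G" "\<not> same_equation F G"
      "no_common_hyperplane n F G"
    then have "(q - 1) * card (zero_locus n F \<inter> zero_locus n G) + 1 + 3 * q ^ (n - 2) \<le> 4 * q ^ (n - 1)"
      using card_zero_locus_Int[of n F G] card_common_zeros_quadrics_le[of F n G] assms by simp
    then have "(q - 1) * card (zero_locus n F \<inter> zero_locus n G) \<le> (q - 1) * b"
      using b by linarith
    then show "card (zero_locus n F \<inter> zero_locus n G) \<le> 4 * q ^ (n - 2) + proj_count q (n - 3)"
      using q2 by (simp add: b_def)
  }
  show "\<exists>F\<^sub>1 F\<^sub>2 :: 'a mpoly.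
            F\<^sub>1 \<noteq> 0 \<and> is_form n 2 F\<^sub>1 \<and> F\<^sub>2 \<noteq> 0 \<and> is_form n 2 F\<^sub>2 \<and>
            zero_locus n F\<^sub>1 \<noteq> zero_locus n F\<^sub>2 \<and> no_common_hyperplane n F\<^sub>1 F\<^sub>2 \<and>
            card (zero_locus n F\<^sub>1 \<inter> zero_locus n F\<^sub>2) = 4 * q ^ (n - 2) + proj_count q (n - 3)"
  proof (intro exI conjI)
    let ?F = "split_quadric 0 2 :: 'a mpoly" and ?G = "split_quadric 1 2 :: 'a mpoly"
    show F: "is_form n 2 ?F" and G: "is_form n 2 ?G"
      using assms(2) by (auto intro: is_form_split_quadric)
    show "no_common_hyperplane n ?F ?G"
      by (rule no_common_hyperplane_split_quadrics) (use assms(2) in simp)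
    \<comment> \<open>The point of \<open>u\<close> lies on the second quadric but not on the first,
      so the two loci differ.\<close>
    define u :: "nat \<Rightarrow> 'a" where "u = (\<lambda>i. if i = 0 then 1 else 0)"
    have u: "u \<in> nonzero_vectors n" by (auto simp: u_def nonzero_vectors_def)
    have Fu: "poly_eval ?F u \<noteq> 0" by (simp add: poly_eval_split_quadric u_def)
    then show "?F \<noteq> 0" by auto
    have "poly_eval ?G (\<lambda>i. if i = 1 then 1 else 0) \<noteq> 0" by (simp add: poly_eval_split_quadric)
    then show "?G \<noteq> 0" by auto
    have "poly_eval ?G w = 0" if "w \<in> proportional n `` {u}" for w
      using that unfolding proportional_class[OF u] by (auto simp: poly_eval_split_quadric u_def)
    then have "proportional n `` {u} \<in> zero_locus n ?G"
      using u by (auto simp: zero_locus_def proj_space_def intro: quotientI)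
    moreover have "proportional n `` {u} \<notin> zero_locus n ?F"
      using Fu equiv_class_self[OF equiv_proportional u] by (auto simp: zero_locus_def)
    ultimately show "zero_locus n ?F \<noteq> zero_locus n ?G" by blast
    have "(q - 1) * card (zero_locus n ?F \<inter> zero_locus n ?G) + 1 + 3 * q ^ (n - 2) = 4 * q ^ (n - 1)"
      using card_zero_locus_Int[OF F G] card_common_zeros_split_quadrics[of n, where 'a = 'a] assms
      by simp
    then have "(q - 1) * card (zero_locus n ?F \<inter> zero_locus n ?G) = (q - 1) * b"
      using b by linarith
    then show "card (zero_locus n ?F \<inter> zero_locus n ?G) = 4 * q ^ (n - 2) + proj_count q (n - 3)"
      using q2 by (simp add: b_def)
  qed
qed

end
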